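(* Let $A$ be a C*-algebra acting on a Hilbert space $H$. Then there exist unique C*-subalgebras $A_I$, $A_{II}$, $A_{III}$ of $A$ such that (a) $A_I$ is a C*-algebra of von Neumann type I; there does not exist a nonzero Abelian annihilator in the algebras $A_{II}$ and $A_{III}$; the lattice $\mathcal{P}_{A_{II}}$ is locally modular; and the lattice $\mathcal{P}_{A_{III}}$ is purely nonmodular; (b) $A_I$, $A_{II}$, $A_{III}$ belong to $Z(\mathcal{P}_A)$ (i.e. are central annihilators of $A$); (c) $A_I\oplus A_{II}\oplus A_{III}$ is a C*-subalgebra of $A$ and $\mathrm{Ann}_A(A_I\oplus A_{II}\oplus A_{III})=\{0\}$.
   Context: For a C*-algebra $B$: $B_+$ is its positive part; for $S\subseteq B$, $\mathrm{Ann}_B(S)=\{a\in B: as+sa=0 \text{ for all } s\in S\}$. The set of annihilators of $B$ is $\mathcal{P}_B=\{V\subseteq B: V=\mathrm{Ann}_B(\mathrm{Ann}_B(S)) \text{ for some } S\subseteq B_+\}$, ordered by inclusion; it is a complete lattice, suprema being taken in $\mathcal{P}_B$. For $V\subseteq B$ let ${}^dV=\{a\in B: xay+yax=0 \text{ for all } x,y\in V\}$. An annihilator $V\in\mathcal{P}_B$ is central if ${}^d(\mathrm{Ann}_B(\mathrm{Ann}_B(S)))\cap{}^d(\mathrm{Ann}_B(S))=\{0\}$, where $S\subseteq B_+$ and $V=\mathrm{Ann}_B(\mathrm{Ann}_B(S))$; $Z(\mathcal{P}_B)$ denotes the set of central annihilators. The central support $c(V)$ of $V\in\mathcal{P}_B$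 is the greatest lower bound in $\mathcal{P}_B$ of the central annihilators containing $V$. $V\in\mathcal{P}_B$ is Abelian if it is commutative. $B$ is of von Neumann type I if there is an Abelian annihilator $V$ with $c(V)=B$. Every annihilator $V$ is a C*-subalgebra, and $\mathcal{P}_V$ denotes the set of annihilators of $V$ computed inside the C*-algebra $V$; $V$ is modular if $\mathcal{P}_V$ is a modular lattice. Two annihilators $V,W$ are orthogonal if $V\cdot W=\{vw: v\in V,w\in W\}=\{0\}$. The lattice $\mathcal{P}_B$ is locally modular if there exists a family $\{V_\xi\}$ of modular annihilators whose central supports $\{Z_\xi\}$ are pairwise orthogonal and satisfy $\sup_\xi Z_\xi=B$; it is purely nonmodular if there is no nonzero modular annihilator in $\mathcal{P}_B$. *)

theory Defs
  imports Complex_Main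
begin

text \<open>Complex Banach *-algebras satisfying the C*-identity. The ambient type plays the
role of the algebra of bounded operators B(H); the algebra A of the theorem is a
C*-subalgebra (norm-closed *-subalgebra) of it.\<close>

class cstar_algebra = real_normed_algebra + banach +
  fixes scaleC :: "complex \<Rightarrow> 'a \<Rightarrow> 'a"
    and adj :: "'a \<Rightarrow> 'a"
  assumes scaleC_add_right: "scaleC c (x + y) = scaleC c x + scaleC c y"
    and scaleC_add_left: "scaleC (c + d) x = scaleC c x + scaleC d x"
    and scaleC_scaleC: "scaleC c (scaleC d x) = scaleC (c * d) x"
    and scaleC_one: "scaleC 1 x = x"
    and scaleR_scaleC: "scaleR r x = scaleC (complex_of_real r) x"
    and norm_scaleC: "norm (scaleC c x) = cmod c * norm x"
    and mult_scaleC_left: "scaleC c x * y = scaleC c (x * y)"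
    and mult_scaleC_right: "x * scaleC c y = scaleC c (x * y)"
    and adj_adj: "adj (adj x) = x"
    and adj_add: "adj (x + y) = adj x + adj y"
    and adj_mult: "adj (x * y) = adj y * adj x"
    and adj_scaleC: "adj (scaleC c x) = scaleC (cnj c) (adj x)"
    and cstar_identity: "norm (adj x * x) = (norm x)\<^sup>2"

definition cstar_subalg :: "'a::cstar_algebra set \<Rightarrow> bool" where
  "cstar_subalg B \<longleftrightarrow> 0 \<in> B \<and> (\<forall>x\<in>B. \<forall>y\<in>B. x + y \<in> B \<and> x * y \<in> B)
     \<and> (\<forall>c. \<forall>x\<in>B. scaleC c x \<in> B) \<and> (\<forall>x\<in>B. adj x \<in> B) \<and> closed B"

definition pos_part :: "'a::cstar_algebra set \<Rightarrow> 'a set" where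
  "pos_part B = {a. \<exists>x\<in>B. a = adj x * x}"

definition Ann :: "'a::cstar_algebra set \<Rightarrow> 'a set \<Rightarrow> 'a set" where
  "Ann B S = {a \<in> B. \<forall>s\<in>S. a * s + s * a = 0}"

definition annihilators :: "'a::cstar_algebra set \<Rightarrow> 'a set set" where
  "annihilators B = {V. \<exists>S. S \<subseteq> pos_part B \<and> V = Ann B (Ann B S)}"

definition dset :: "'a::cstar_algebra set \<Rightarrow> 'a set \<Rightarrow> 'a set" where
  "dset B V = {a \<in> B. \<forall>x\<in>V. \<forall>y\<in>V. x * a * y + y * a * x = 0}"

definition central_ann :: "'a::cstar_algebra set \<Rightarrow> 'a set set" where
  "central_ann B = {V. \<exists>S. S \<subseteq> pos_part B \<and> V = Ann B (Ann B S)
       \<and> dset B (Ann B (Ann B S)) \<inter> dset B (Ann B S) = {0}}"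

definition is_lub_P :: "'a::cstar_algebra set \<Rightarrow> 'a set set \<Rightarrow> 'a set \<Rightarrow> bool" where
  "is_lub_P B F W \<longleftrightarrow> W \<in> annihilators B \<and> (\<forall>V\<in>F. V \<subseteq> W)
     \<and> (\<forall>U\<in>annihilators B. (\<forall>V\<in>F. V \<subseteq> U) \<longrightarrow> W \<subseteq> U)"

definition is_glb_P :: "'a::cstar_algebra set \<Rightarrow> 'a set set \<Rightarrow> 'a set \<Rightarrow> bool" where
  "is_glb_P B F W \<longleftrightarrow> W \<in> annihilators B \<and> (\<forall>V\<in>F. W \<subseteq> V)
     \<and> (\<forall>U\<in>annihilators B. (\<forall>V\<in>F. U \<subseteq> V) \<longrightarrow> U \<subseteq> W)"

definition sup_P :: "'a::cstar_algebra set \<Rightarrow> 'a set \<Rightarrow> 'a set \<Rightarrow> 'a set" where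
  "sup_P B X Y = (THE W. is_lub_P B {X, Y} W)"

definition inf_P :: "'a::cstar_algebra set \<Rightarrow> 'a set \<Rightarrow> 'a set \<Rightarrow> 'a set" where
  "inf_P B X Y = (THE W. is_glb_P B {X, Y} W)"

definition central_support :: "'a::cstar_algebra set \<Rightarrow> 'a set \<Rightarrow> 'a set" where
  "central_support B V = (THE W. is_glb_P B {Z \<in> central_ann B. V \<subseteq> Z} W)"

definition abelian :: "'a::cstar_algebra set \<Rightarrow> bool" where
  "abelian V \<longleftrightarrow> (\<forall>x\<in>V. \<forall>y\<in>V. x * y = y * x)"

definition vN_type_I :: "'a::cstar_algebra set \<Rightarrow> bool" where
  "vN_type_I B \<longleftrightarrow> (\<exists>V\<in>annihilators B. abelian V \<and> central_support B V = B)"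

definition modular_alg :: "'a::cstar_algebra set \<Rightarrow> bool" where
  "modular_alg V \<longleftrightarrow> (\<forall>X\<in>annihilators V. \<forall>Y\<in>annihilators V. \<forall>W\<in>annihilators V.
      X \<subseteq> W \<longrightarrow> sup_P V X (inf_P V Y W) = inf_P V (sup_P V X Y) W)"

definition orthogonal :: "'a::cstar_algebra set \<Rightarrow> 'a set \<Rightarrow> bool" where
  "orthogonal V W \<longleftrightarrow> (\<forall>v\<in>V. \<forall>w\<in>W. v * w = 0)"

text \<open>Locally modular: a family of modular annihilators whose central supports are pairwise
orthogonal and have supremum B in P_B. (The family is represented by its set of members.)\<close>
definition locally_modular :: "'a::cstar_algebra set \<Rightarrow> bool" where
  "locally_modular B \<longleftrightarrow> (\<exists>F. F \<subseteq> annihilators B \<and> (\<forall>V\<in>F. modular_alg V)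
      \<and> (\<forall>V\<in>F. \<forall>W\<in>F. V \<noteq> W \<longrightarrow> orthogonal (central_support B V) (central_support B W))
      \<and> is_lub_P B (central_support B ` F) B)"

definition purely_nonmodular :: "'a::cstar_algebra set \<Rightarrow> bool" where
  "purely_nonmodular B \<longleftrightarrow> (\<forall>V\<in>annihilators B. modular_alg V \<longrightarrow> V = {0})"

definition no_abelian_ann :: "'a::cstar_algebra set \<Rightarrow> bool" where
  "no_abelian_ann B \<longleftrightarrow> (\<forall>V\<in>annihilators B. abelian V \<longrightarrow> V = {0})"

definition sum3 :: "'a::cstar_algebra set \<Rightarrow> 'a set \<Rightarrow> 'a set \<Rightarrow> 'a set" where
  "sum3 X Y Z = {x + y + z | x y z. x \<in> X \<and> y \<in> Y \<and> z \<in> Z}"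

definition type_decomposition ::
  "'a::cstar_algebra set \<Rightarrow> 'a set \<Rightarrow> 'a set \<Rightarrow> 'a set \<Rightarrow> bool" where
  "type_decomposition A AI AII AIII \<longleftrightarrow>
     cstar_subalg AI \<and> AI \<subseteq> A \<and> cstar_subalg AII \<and> AII \<subseteq> A \<and> cstar_subalg AIII \<and> AIII \<subseteq> A
     \<comment> \<open>(a)\<close>
     \<and> vN_type_I AI \<and> no_abelian_ann AII \<and> no_abelian_ann AIII
     \<and> locally_modular AII \<and> purely_nonmodular AIII
     \<comment> \<open>(b)\<close>
     \<and> AI \<in> central_ann A \<and> AII \<in> central_ann A \<and> AIII \<in> central_ann A
     \<comment> \<open>(c): the (orthogonal, internal) direct sum\<close>
     \<and> orthogonal AI AII \<and> orthogonal AII AI \<and> orthogonal AI AIII \<and> orthogonal AIII AI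
     \<and> orthogonal AII AIII \<and> orthogonal AIII AII
     \<and> cstar_subalg (sum3 AI AII AIII) \<and> sum3 AI AII AIII \<subseteq> A
     \<and> Ann A (sum3 AI AII AIII) = {0}"

end

theory Submission
  imports Defs "HOL-Analysis.Elementary_Metric_Spaces" "HOL-Analysis.Operator_Norm"
begin

text \<open>The analytic input is that \<open>a s + s a = 0\<close> with \<open>s = x* x\<close> forces \<open>a s = s a = 0\<close>. It rests on the
  positivity of \<open>x* x\<close>, obtained after adjoining a unit by Kaplansky's argument; continuous functional
  calculus is replaced by the elements \<open>x (1 - s)\<^sup>k\<close>, which isolate the negative part of \<open>s\<close>.
  Consequently annihilators are the double orthogonal complements with respect to the relation
  \<open>a b = b a = 0\<close>, and the central ones are those that are ideals. The annihilators of a central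
  annihilator \<open>Z\<close> are the annihilators of the whole algebra contained in \<open>Z\<close>, so all type conditions
  may be tested in the whole algebra. The type I part is the supremum of the central supports in a
  maximal family of Abelian annihilators with orthogonal central supports, the type II part arises in
  the same way from modular annihilators in its complement, and the type III part is what remains.
  Uniqueness holds because summands of different types are orthogonal, even when taken from two
  different decompositions.\<close>

section \<open>Elementary consequences of the C*-axioms\<close>

text \<open>Positivity is what separates anticommutation from orthogonality: the matrix diag(1, -1)
  anticommutes with the flip of the two coordinates. The ambient type offers only the C*-identity
  and no Hilbert space vectors, so positivity of \<open>adj x * x\<close> has to be extracted from
  norm estimates. A C*-algebra may contain too few projections; annihilators take over their role in
  the von Neumann decomposition, and suprema are double complements. This is why the three summands
  have trivial annihilator but need not add up to \<open>A\<close>. Being an annihilator depends on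
  the algebra in which complements are formed. Below a central annihilator the two readings agree,
  but uniqueness also has to cut a modular \<open>V\<close> that is not central by a central
  \<open>Y\<close>, and modularity survives only because \<open>V \<inter> Y\<close> is central in
  \<open>V\<close>.\<close>

lemma scaleC_zero_left: "scaleC 0 (x::'a::cstar_algebra) = 0"
  using scaleR_scaleC[of 0 x] by simp

lemma scaleC_zero_right: "scaleC c (0::'a::cstar_algebra) = 0"
  using scaleC_add_right[of c 0 "0::'a"] by simp

lemma scaleC_minus_right: "scaleC c (- x) = - scaleC c (x::'a::cstar_algebra)"
proof -
  have "scaleC c (- x) + scaleC c x = 0"
    using scaleC_add_right[of c "- x" x] by (simp add: scaleC_zero_right)
  then show ?thesis by (simp add: eq_neg_iff_add_eq_0)
qed

lemma scaleC_diff_right: "scaleC c (x - y) = scaleC c x - scaleC c (y::'a::cstar_algebra)"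
  using scaleC_add_right[of c x "- y"] by (simp add: scaleC_minus_right)

lemma scaleC_minus_one: "scaleC (- 1) (x::'a::cstar_algebra) = - x"
  using scaleR_scaleC[of "- 1" x] by simp

lemma adj_zero [simp]: "adj (0::'a::cstar_algebra) = 0"
  using adj_add[of 0 "0::'a"] by simp

lemma adj_scaleR: "adj (r *\<^sub>R x) = r *\<^sub>R adj (x::'a::cstar_algebra)"
  by (simp add: scaleR_scaleC adj_scaleC)

lemma adj_minus: "adj (- x) = - adj (x::'a::cstar_algebra)"
  using adj_scaleR[of "- 1" x] by simp

lemma adj_diff: "adj (x - y) = adj x - adj (y::'a::cstar_algebra)"
  using adj_add[of x "- y"] by (simp add: adj_minus)

declare adj_adj [simp]

lemma norm_adj: "norm (adj x) = norm (x::'a::cstar_algebra)"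
proof -
  have le: "norm y \<le> norm (adj y)" for y :: 'a
  proof (cases "y = 0")
    case False
    have "norm y * norm y \<le> norm (adj y) * norm y"
      using norm_mult_ineq[of "adj y" y] by (simp add: cstar_identity power2_eq_square)
    then show ?thesis using False by simp
  qed simp
  from le[of x] le[of "adj x"] show ?thesis by simp
qed

lemma bounded_linear_adj: "bounded_linear (adj :: 'a::cstar_algebra \<Rightarrow> 'a)"
  by (rule bounded_linear_intro[where K = 1]) (simp_all add: adj_add adj_scaleR norm_adj)

lemmas continuous_on_adj [continuous_intros] = bounded_linear.continuous_on[OF bounded_linear_adj]

lemma adj_mult_self_eq_0: "adj x * x = 0 \<Longrightarrow> (x::'a::cstar_algebra) = 0"
  using cstar_identity[of x] by simp

lemma mult_adj_self_eq_0: "x * adj x = 0 \<Longrightarrow> (x::'a::cstar_algebra) = 0"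
  using adj_mult_self_eq_0[of "adj x"] adj_adj[of x] adj_zero by metis

lemma norm_mult_adj_self: "norm (x * adj x) = (norm (x::'a::cstar_algebra))\<^sup>2"
  using cstar_identity[of "adj x"] by (simp add: norm_adj)

lemma norm_square_selfadjoint: "adj h = h \<Longrightarrow> norm (h * h) = (norm (h::'a::cstar_algebra))\<^sup>2"
  using cstar_identity[of h] by simp

section \<open>Positivity in unital C*-algebras\<close>

class cstar_algebra_1 = cstar_algebra + real_normed_algebra_1

lemma adj_one [simp]: "adj (1::'a::cstar_algebra_1) = 1"
  by (metis adj_adj adj_mult mult_1_right)

lemma adj_power: "adj (x ^ n) = adj (x::'a::cstar_algebra_1) ^ n"
  by (induction n) (simp_all add: adj_mult power_commutes)

text \<open>The square root is \<open>1 - r\<close>, where \<open>r\<close> is the fixed point of the contraction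
  \<open>r \<mapsto> (h + r\<^sup>2) / 2\<close>.\<close>

lemma sqrt_one_minus:
  fixes h :: "'a::cstar_algebra_1"
  assumes h: "adj h = h" "norm h < 1"
  obtains c where "adj c = c" "c * c = 1 - h" "\<And>y. y * h = h * y \<Longrightarrow> y * c = c * y"
proof -
  \<comment> \<open>Self-adjointness and commutation with everything that commutes with
    \<open>h\<close> are closed conditions preserved by \<open>f\<close>, so the fixed point
    inherits them.\<close>
  define S where "S = {r. norm r \<le> norm h \<and> adj r = r \<and> (\<forall>y. y * h = h * y \<longrightarrow> y * r = r * y)}"
  define f where "f r = (1/2) *\<^sub>R (h + r * r)" for r :: 'a
  have "closed S"
    unfolding S_def
    by (intro closed_Collect_conj closed_Collect_all closed_Collect_imp closed_Collect_le
        closed_Collect_eq continuous_intros) auto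
  then have compl: "complete S" by (simp add: complete_eq_closed)
  have ne: "S \<noteq> {}" unfolding S_def using h by (auto intro!: exI[of _ 0])
  have "norm (f r) \<le> norm h" if "r \<in> S" for r
  proof -
    have r: "norm r \<le> norm h" using that by (simp add: S_def)
    have "norm (r * r) \<le> norm h * norm h"
      using norm_mult_ineq[of r r] mult_mono[OF r r] by simp
    also have "\<dots> \<le> norm h" using h(2) mult_left_le[of "norm h" "norm h"] by simp
    finally show ?thesis using norm_triangle_ineq[of h "r * r"] by (simp add: f_def)
  qed
  moreover have "y * f r = f r * y" if "r \<in> S" "y * h = h * y" for r y
  proof -
    have "y * r = r * y" using that by (auto simp: S_def)
    then have "y * (r * r) = r * r * y" by (metis mult.assoc)
    then show ?thesis using that(2) by (simp add: f_def distrib_left distrib_right)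
  qed
  moreover have "adj (f r) = f r" if "r \<in> S" for r
  proof -
    have "adj r = r" using that unfolding S_def by blast
    then show ?thesis using h(1) by (simp add: f_def adj_scaleR adj_add adj_mult)
  qed
  ultimately have fS: "f ` S \<subseteq> S" by (auto simp: S_def)
  have lip: "dist (f x) (f y) \<le> norm h * dist x y" if "x \<in> S" "y \<in> S" for x y
  proof -
    have n: "norm x \<le> norm h" "norm y \<le> norm h" using that by (simp_all add: S_def)
    have "f x - f y = (1/2) *\<^sub>R (x * (x - y) + (x - y) * y)"
    proof -
      have "f x - f y = (1/2) *\<^sub>R ((h + x * x) - (h + y * y))"
        unfolding f_def by (rule scaleR_diff_right[symmetric])
      also have "(h + x * x) - (h + y * y) = x * (x - y) + (x - y) * y" by (simp add: algebra_simps)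
      finally show ?thesis .
    qed
    then have "norm (f x - f y) \<le> (norm (x * (x - y)) + norm ((x - y) * y)) / 2"
      using norm_triangle_ineq[of "x * (x - y)" "(x - y) * y"] by simp
    also have "\<dots> \<le> (norm h * norm (x - y) + norm (x - y) * norm h) / 2"
      by (intro divide_right_mono add_mono order_trans[OF norm_mult_ineq] mult_mono) (use n in auto)
    finally show ?thesis by (simp add: dist_norm mult.commute)
  qed
  obtain r where r: "r \<in> S" "f r = r"
    using Banach_fix[OF compl ne _ h(2) fS lip] by auto
  have "r + r = h + r * r"
    using arg_cong[OF r(2), of "\<lambda>z. 2 *\<^sub>R z"] by (simp add: f_def scaleR_2)
  then have "(1 - r) * (1 - r) = 1 - h" by (simp add: algebra_simps)
  moreover have "adj (1 - r) = 1 - r" using r(1) by (simp add: S_def adj_diff)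
  moreover have "y * (1 - r) = (1 - r) * y" if "y * h = h * y" for y
    using r(1) that by (simp add: S_def algebra_simps)
  ultimately show thesis using that by blast
qed

text \<open>The element \<open>x + \<i> y\<close> is \<open>sqrt \<eta>\<close> times a unitary, and \<open>x\<^sup>2 - y\<^sup>2\<close> is the real part of its
  square.\<close>

lemma norm_square_diff_le:
  fixes x y :: "'a::cstar_algebra_1"
  assumes sa: "adj x = x" "adj y = y" and comm: "x * y = y * x"
    and sum: "x * x + y * y = \<eta> *\<^sub>R 1" and "\<eta> \<ge> 0"
  shows "norm (x * x - y * y) \<le> \<eta>"
proof -
  define u where "u = x + scaleC \<i> y"
  have au: "adj u = x - scaleC \<i> y"
    using scaleC_scaleC[of "-1" \<i> y]
    by (simp add: u_def adj_add adj_scaleC sa scaleC_minus_one)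
  have ii: "scaleC \<i> (scaleC \<i> z) = - z" for z :: 'a
    by (simp add: scaleC_scaleC scaleC_minus_one)
  have "adj u * u = x * x + y * y"
    unfolding au unfolding u_def
    by (simp add: algebra_simps mult_scaleC_left mult_scaleC_right scaleC_add_right
        scaleC_diff_right ii comm)
  then have nu: "(norm u)\<^sup>2 = \<eta>" using cstar_identity[of u] sum assms(5) by simp
  have "u * u + adj u * adj u = 2 *\<^sub>R (x * x - y * y)"
    unfolding au unfolding u_def
    by (simp add: algebra_simps mult_scaleC_left mult_scaleC_right scaleC_add_right
        scaleC_diff_right ii scaleR_2)
  then have "2 * norm (x * x - y * y) = norm (u * u + adj u * adj u)" by simp
  also have "\<dots> \<le> norm u * norm u + norm (adj u) * norm (adj u)"
    by (intro order_trans[OF norm_triangle_ineq] add_mono norm_mult_ineq)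
  finally show ?thesis using nu by (simp add: norm_adj power2_eq_square)
qed

text \<open>For a self-adjoint element this says that its spectrum lies in \<open>[0, \<infinity>)\<close>.\<close>

definition nonneg :: "'a::cstar_algebra_1 \<Rightarrow> bool" where
  "nonneg p \<longleftrightarrow> adj p = p \<and> (\<exists>\<mu>\<ge>0. norm (\<mu> *\<^sub>R 1 - p) \<le> \<mu>)"

lemma nonneg_bound_ge:
  assumes "nonneg p"
  obtains \<mu> where "\<mu> \<ge> K" "\<mu> > 0" "norm (\<mu> *\<^sub>R 1 - p) \<le> \<mu>"
proof -
  obtain l where l: "l \<ge> 0" "norm (l *\<^sub>R 1 - p) \<le> l" using assms by (auto simp: nonneg_def)
  define m where "m = l + \<bar>K\<bar> + 1"
  have "norm ((l *\<^sub>R 1 - p) + (m - l) *\<^sub>R 1) \<le> l + (m - l)"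
    by (intro order_trans[OF norm_triangle_ineq] add_mono l) (simp add: m_def)
  then have "norm (m *\<^sub>R 1 - p) \<le> m" by (simp add: algebra_simps)
  then show thesis using that[of m] l by (simp add: m_def)
qed

lemma nonneg_const: "r \<ge> 0 \<Longrightarrow> nonneg (r *\<^sub>R 1)"
  unfolding nonneg_def by (auto simp: adj_scaleR intro!: exI[of _ r])

lemma nonneg_add:
  assumes "nonneg p" "nonneg q"
  shows "nonneg (p + q)"
proof -
  obtain l m where l: "l \<ge> 0" "norm (l *\<^sub>R 1 - p) \<le> l" and m: "m \<ge> 0" "norm (m *\<^sub>R 1 - q) \<le> m"
    using assms by (auto simp: nonneg_def)
  have "norm ((l *\<^sub>R 1 - p) + (m *\<^sub>R 1 - q)) \<le> l + m"
    by (intro order_trans[OF norm_triangle_ineq] add_mono l m)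
  then have "norm ((l + m) *\<^sub>R 1 - (p + q)) \<le> l + m" by (simp add: algebra_simps)
  moreover have "adj (p + q) = p + q" using assms by (simp add: nonneg_def adj_add)
  ultimately show ?thesis unfolding nonneg_def using l(1) m(1) by (intro conjI exI[of _ "l + m"]) auto
qed

lemma nonneg_scaleR:
  assumes "nonneg p" "r \<ge> 0"
  shows "nonneg (r *\<^sub>R p)"
proof -
  obtain l where l: "l \<ge> 0" "norm (l *\<^sub>R 1 - p) \<le> l" using assms by (auto simp: nonneg_def)
  have "norm ((r * l) *\<^sub>R 1 - r *\<^sub>R p) = r * norm (l *\<^sub>R 1 - p)"
    using assms(2) by (metis norm_scaleR abs_of_nonneg scaleR_diff_right scaleR_scaleR)
  also have "\<dots> \<le> r * l" using l assms(2) by (intro mult_left_mono)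
  finally show ?thesis
    using assms l by (auto simp: nonneg_def adj_scaleR intro!: exI[of _ "r * l"])
qed

text \<open>Rescale to \<open>k\<close> of norm below 1 and take the root \<open>c\<close> of
  \<open>1 - k * k\<close>, which commutes with \<open>k\<close>. From
  \<open>c * c + k * k = 1\<close> the norm of \<open>c * c - k * k\<close> is at most 1, and
  averaging this element with 1 gives \<open>1 - k * k\<close>.\<close>

lemma nonneg_square:
  fixes h :: "'a::cstar_algebra_1"
  assumes "adj h = h"
  shows "nonneg (h * h)"
proof -
  define t where "t = norm h + 1"
  define k where "k = inverse t *\<^sub>R h"
  have t: "t > 0" by (simp add: t_def add_nonneg_pos)
  have k: "adj k = k" by (simp add: k_def adj_scaleR assms)
  have "norm k < 1" using t by (simp add: k_def t_def field_simps)
  then have "norm (k * k) < 1"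
    by (simp add: norm_square_selfadjoint[OF k] power_less_one_iff)
  moreover have "adj (k * k) = k * k" by (simp add: adj_mult k)
  ultimately obtain c where c: "adj c = c" "c * c = 1 - k * k"
    and comm: "\<And>y. y * (k * k) = (k * k) * y \<Longrightarrow> y * c = c * y"
    using sqrt_one_minus by metis
  have "k * c = c * k" by (rule comm) (simp add: mult.assoc)
  then have "norm (c * c - k * k) \<le> 1"
    by (intro norm_square_diff_le) (simp_all add: c k)
  moreover have "2 *\<^sub>R (1 - k * k) = 1 + (c * c - k * k)"
    by (simp add: c scaleR_2)
  ultimately have "2 * norm (1 - k * k) \<le> 1 + 1"
    by (metis norm_scaleR abs_numeral norm_triangle_le norm_one add_left_mono)
  then have "nonneg (k * k)"
    using \<open>adj (k * k) = k * k\<close> by (auto simp: nonneg_def intro!: exI[of _ 1])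
  then have "nonneg (t\<^sup>2 *\<^sub>R (k * k))" by (rule nonneg_scaleR) simp
  moreover have "t\<^sup>2 * (inverse t * inverse t) = 1" using t by (simp add: power2_eq_square field_simps)
  ultimately show ?thesis by (simp add: k_def)
qed

text \<open>The shift by \<open>\<delta>\<close> makes the norm of \<open>k\<close> strictly less
  than 1, as the contraction behind \<open>sqrt_one_minus\<close> demands.\<close>

lemma nonneg_sqrt:
  fixes p :: "'a::cstar_algebra_1"
  assumes p: "nonneg p" and "\<delta> > 0"
  obtains d where "adj d = d" "d * d = p + \<delta> *\<^sub>R 1" "\<And>y. y * p = p * y \<Longrightarrow> y * d = d * y"
proof -
  obtain l where l: "l \<ge> 0" "norm (l *\<^sub>R 1 - p) \<le> l" using assms by (auto simp: nonneg_def)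
  define m where "m = l + \<delta>"
  have m: "m > 0" using l assms by (simp add: m_def)
  define k where "k = inverse m *\<^sub>R (l *\<^sub>R 1 - p)"
  have "norm k = inverse m * norm (l *\<^sub>R 1 - p)" using m by (simp add: k_def)
  also have "\<dots> \<le> inverse m * l" using l(2) m by (intro mult_left_mono) auto
  also have "\<dots> < 1" using m assms(2) by (simp add: m_def field_simps)
  finally have "norm k < 1" .
  moreover have "adj k = k" using p by (simp add: k_def adj_scaleR adj_diff nonneg_def)
  ultimately obtain c where c: "adj c = c" "c * c = 1 - k" "\<And>y. y * k = k * y \<Longrightarrow> y * c = c * y"
    using sqrt_one_minus by metis
  show thesis
  proof (rule that[of "sqrt m *\<^sub>R c"])
    show "adj (sqrt m *\<^sub>R c) = sqrt m *\<^sub>R c" by (simp add: adj_scaleR c)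
    have "m *\<^sub>R (1 - k) = p + \<delta> *\<^sub>R 1" using m
      by (simp add: k_def scaleR_diff_right m_def scaleR_add_left)
    then show "(sqrt m *\<^sub>R c) * (sqrt m *\<^sub>R c) = p + \<delta> *\<^sub>R 1" using m c(2) by simp
    show "y * (sqrt m *\<^sub>R c) = (sqrt m *\<^sub>R c) * y" if "y * p = p * y" for y
      using c(3)[of y] that by (simp add: k_def algebra_simps)
  qed
qed

text \<open>Commuting roots \<open>c\<close>, \<open>d\<close> of the two shifted elements satisfy
  \<open>c * c + d * d = 2 (\<epsilon> + \<delta>)\<close> and \<open>c * c - d * d = 2 p\<close>,
  so \<open>norm_square_diff_le\<close> applies; then \<delta> tends to 0.\<close>

lemma norm_le_of_nonneg:
  fixes p :: "'a::cstar_algebra_1"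
  assumes "nonneg (\<epsilon> *\<^sub>R 1 + p)" "nonneg (\<epsilon> *\<^sub>R 1 - p)" "\<epsilon> \<ge> 0"
  shows "norm p \<le> \<epsilon>"
proof (rule field_le_epsilon)
  fix \<delta> :: real assume \<delta>: "\<delta> > 0"
  obtain c where c: "adj c = c" "c * c = (\<epsilon> *\<^sub>R 1 + p) + \<delta> *\<^sub>R 1"
    "\<And>y. y * (\<epsilon> *\<^sub>R 1 + p) = (\<epsilon> *\<^sub>R 1 + p) * y \<Longrightarrow> y * c = c * y"
    using nonneg_sqrt[OF assms(1) \<delta>] by metis
  obtain d where d: "adj d = d" "d * d = (\<epsilon> *\<^sub>R 1 - p) + \<delta> *\<^sub>R 1"
    "\<And>y. y * (\<epsilon> *\<^sub>R 1 - p) = (\<epsilon> *\<^sub>R 1 - p) * y \<Longrightarrow> y * d = d * y"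
    using nonneg_sqrt[OF assms(2) \<delta>] by metis
  have "p * c = c * p" by (rule c(3)) (simp add: algebra_simps)
  then have "c * d = d * c" by (intro d(3)) (simp add: algebra_simps)
  then have "norm (c * c - d * d) \<le> 2 * (\<epsilon> + \<delta>)"
    using \<delta> assms(3)
    by (intro norm_square_diff_le) (simp_all add: c(1,2) d(1,2) scaleR_2 scaleR_add_left flip: scaleR_scaleR)
  moreover have "c * c - d * d = 2 *\<^sub>R p" by (simp add: c d scaleR_2)
  ultimately show "norm p \<le> \<epsilon> + \<delta>" by simp
qed

section \<open>Growth of powers and positivity of \<open>adj x * x\<close>\<close>

lemma norm_power_two_power:
  fixes b :: "'a::cstar_algebra_1"
  assumes "adj b = b"
  shows "norm (b ^ 2 ^ m) = norm b ^ 2 ^ m"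
proof (induction m)
  case (Suc m)
  have "b ^ 2 ^ Suc m = b ^ 2 ^ m * b ^ 2 ^ m" by (simp add: mult_2 power_add)
  then have "norm (b ^ 2 ^ Suc m) = (norm (b ^ 2 ^ m))\<^sup>2"
    by (simp add: norm_square_selfadjoint adj_power assms)
  then show ?case using Suc by (simp add: power_mult power_mult_distrib power2_eq_square)
qed simp

text \<open>A stand-in for the spectral radius formula: along the exponents \<open>2 ^ N\<close> the
  norm of a self-adjoint element is multiplicative, and a linear factor loses against a geometric
  one.\<close>

lemma norm_le_of_power_growth:
  fixes b :: "'a::cstar_algebra_1"
  assumes b: "adj b = b" and "\<mu> > 0" and growth: "\<And>k. norm (b ^ k) \<le> K * real (Suc k) * \<mu> ^ k"
  shows "norm b \<le> \<mu>"
proof (rule ccontr)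
  assume gt: "\<not> norm b \<le> \<mu>"
  define c where "c = \<mu> / norm b"
  have nb: "norm b > 0" using gt assms(2) by linarith
  then have c: "0 < c" "c < 1" using gt assms(2) by (simp_all add: c_def)
  have "(\<lambda>n. of_nat n * c ^ n) \<longlonglongrightarrow> 0" "(\<lambda>n. c ^ n) \<longlonglongrightarrow> 0"
    using c by (intro powser_times_n_limit_0 LIMSEQ_realpow_zero; simp)+
  then have "(\<lambda>n. K * (of_nat n * c ^ n + c ^ n)) \<longlonglongrightarrow> K * (0 + 0)"
    by (intro tendsto_mult_left tendsto_add)
  moreover have "(\<lambda>n. K * (of_nat n * c ^ n + c ^ n)) = (\<lambda>n. K * real (Suc n) * c ^ n)"
    by (simp add: fun_eq_iff algebra_simps)
  ultimately have "(\<lambda>n. K * real (Suc n) * c ^ n) \<longlonglongrightarrow> 0"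
    by (simp only: add_0_left mult_zero_right)
  then have "\<forall>\<^sub>F n in sequentially. K * real (Suc n) * c ^ n < 1"
    by (rule order_tendstoD) simp
  then obtain N where N: "\<And>n. n \<ge> N \<Longrightarrow> K * real (Suc n) * c ^ n < 1"
    by (auto simp: eventually_sequentially)
  define n :: nat where "n = 2 ^ N"
  have "K * real (Suc n) * c ^ n < 1" by (rule N) (simp add: n_def less_imp_le)
  then have "K * real (Suc n) * \<mu> ^ n < norm b ^ n"
    using nb by (simp add: c_def power_divide field_simps)
  with growth[of n] norm_power_two_power[OF b, of N] show False by (simp add: n_def)
qed

text \<open>With \<open>a = \<theta> + w* w\<close> and \<open>b = \<theta> + w w*\<close> one has \<open>b\<^sup>k w = w a\<^sup>k\<close>; hence the powers of \<open>b\<close>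
  grow at most linearly faster than those of the bound on \<open>a\<close>.\<close>

lemma nonneg_diff_mult_adj:
  fixes w :: "'a::cstar_algebra_1"
  assumes "nonneg (\<epsilon> *\<^sub>R 1 - adj w * w)" "\<epsilon> \<ge> 0"
  shows "nonneg (\<epsilon> *\<^sub>R 1 - w * adj w)"
proof -
  obtain l where l: "l \<ge> \<epsilon>" "l > 0" "norm (l *\<^sub>R 1 - (\<epsilon> *\<^sub>R 1 - adj w * w)) \<le> l"
    using nonneg_bound_ge[OF assms(1)] by metis
  \<comment> \<open>This choice gives \<open>a = l - (\<epsilon> - adj w * w)\<close>, so the
    hypothesis reads \<open>norm a \<le> l\<close> and the claim becomes
    \<open>norm b \<le> l\<close>.\<close>
  define \<theta> where "\<theta> = l - \<epsilon>"
  define a where "a = \<theta> *\<^sub>R 1 + adj w * w"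
  define b where "b = \<theta> *\<^sub>R 1 + w * adj w"
  have \<theta>: "0 \<le> \<theta>" "\<theta> \<le> l" using l assms by (auto simp: \<theta>_def)
  have na: "norm a \<le> l" using l(3) by (simp add: a_def \<theta>_def algebra_simps)
  have ab: "b ^ k * w = w * a ^ k" for k
  proof (induction k)
    case (Suc k)
    have bw: "b * w = w * a" by (simp add: a_def b_def algebra_simps)
    have "b ^ Suc k * w = b * (b ^ k * w)" by (simp add: mult.assoc)
    also have "\<dots> = b * w * a ^ k" by (simp add: Suc mult.assoc)
    also have "\<dots> = w * a ^ Suc k" by (simp add: bw mult.assoc)
    finally show ?case .
  qed simp
  \<comment> \<open>\<open>K \<ge> 1\<close> starts the induction; the second bound limits the term
    \<open>w a^k adj w\<close> added in each step to \<open>K * l ^ Suc k\<close>.\<close>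
  define K where "K = max 1 ((norm w)\<^sup>2 / l)"
  have K: "K \<ge> 1" "(norm w)\<^sup>2 \<le> K * l" using l(2) by (auto simp: K_def field_simps max_def)
  have "norm (b ^ k) \<le> K * real (Suc k) * l ^ k" for k
  proof (induction k)
    case 0 show ?case using K by simp
  next
    case (Suc k)
    have "b ^ Suc k = \<theta> *\<^sub>R b ^ k + w * a ^ k * adj w"
      using ab[of k] by (simp add: power_Suc2 b_def distrib_left flip: mult.assoc del: power_Suc)
    then have "norm (b ^ Suc k) \<le> norm (\<theta> *\<^sub>R b ^ k) + norm (w * a ^ k * adj w)"
      by (metis norm_triangle_ineq)
    also have "norm (w * a ^ k * adj w) \<le> norm w * l ^ k * norm w"
    proof -
      have "norm (a ^ k) \<le> l ^ k" using norm_power_ineq[of a k] power_mono[OF na, of k] by simp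
      then show ?thesis
        using norm_mult_ineq[of "w * a ^ k" "adj w"] norm_mult_ineq[of w "a ^ k"]
        by (smt (verit) mult_left_mono mult_right_mono norm_adj norm_ge_zero)
    qed
    also have "norm (\<theta> *\<^sub>R b ^ k) \<le> l * (K * real (Suc k) * l ^ k)"
      using Suc \<theta> l by (simp add: mult_mono del: power_Suc of_nat_Suc)
    also have "norm w * l ^ k * norm w = (norm w)\<^sup>2 * l ^ k" by (simp add: power2_eq_square)
    also have "\<dots> \<le> K * l * l ^ k" using K l by (intro mult_right_mono) auto
    finally show ?case by (simp add: algebra_simps)
  qed
  then have "norm b \<le> l"
    by (intro norm_le_of_power_growth[OF _ l(2)]) (auto simp: b_def adj_add adj_scaleR adj_mult)
  then have "norm (l *\<^sub>R 1 - (\<epsilon> *\<^sub>R 1 - w * adj w)) \<le> l" by (simp add: b_def \<theta>_def algebra_simps)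
  then show ?thesis
    using l(2) by (auto simp: nonneg_def adj_diff adj_scaleR adj_mult intro!: exI[of _ l])
qed

text \<open>Kaplansky's trick: \<open>w w* + w* w = 2 h\<^sup>2 + 2 k\<^sup>2\<close> for \<open>w = h + \<i> k\<close>, so an upper bound on
  \<open>w* w\<close> is also a lower bound on \<open>w w*\<close>.\<close>

lemma norm_square_le_of_nonneg:
  fixes w :: "'a::cstar_algebra_1"
  assumes "nonneg (\<epsilon> *\<^sub>R 1 - adj w * w)" "\<epsilon> \<ge> 0"
  shows "(norm w)\<^sup>2 \<le> \<epsilon>"
proof -
  define h where "h = w + adj w"
  define k where "k = scaleC \<i> (w - adj w)"
  have ii: "scaleC \<i> (scaleC \<i> z) = - z" for z :: 'a
    by (simp add: scaleC_scaleC scaleC_minus_one)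
  have h: "adj h = h" by (simp add: h_def adj_add add.commute)
  have k: "adj k = k"
    using scaleC_scaleC[of "-1" \<i> "adj w - w"]
    by (simp add: k_def adj_diff adj_scaleC scaleC_minus_one flip: scaleC_minus_right)
  have "h * h + k * k = 2 *\<^sub>R (w * adj w + adj w * w)"
    by (simp add: h_def k_def mult_scaleC_left mult_scaleC_right scaleC_diff_right ii
        algebra_simps scaleR_2)
  then have "(1/2) *\<^sub>R (h * h + k * k) + (\<epsilon> *\<^sub>R 1 - adj w * w) = \<epsilon> *\<^sub>R 1 + w * adj w" by simp
  moreover have "nonneg ((1/2) *\<^sub>R (h * h + k * k) + (\<epsilon> *\<^sub>R 1 - adj w * w))"
    by (intro nonneg_add nonneg_scaleR nonneg_square h k assms) simp
  ultimately have "nonneg (\<epsilon> *\<^sub>R 1 + w * adj w)" by metis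
  then have "norm (w * adj w) \<le> \<epsilon>"
    using nonneg_diff_mult_adj[OF assms] assms(2) by (intro norm_le_of_nonneg)
  then show ?thesis by (simp add: norm_mult_adj_self)
qed

text \<open>The differences \<open>v\<^sup>m - v \<cdot> v\<^sup>m\<close> decrease in \<open>m\<close> and add up to at most \<open>1\<close>.\<close>

lemma nonneg_telescope:
  fixes c :: "'a::cstar_algebra_1"
  assumes c: "adj c = c" and v: "v = c * c"
  shows "nonneg (1 - real (Suc m) *\<^sub>R ((1 - v) * v ^ m))"
proof -
  define E where "E m = 1 - v ^ Suc m - real (Suc m) *\<^sub>R ((1 - v) * v ^ m)" for m
  have cv: "c ^ i * v = v * c ^ i" for i
    by (simp add: v power_commutes flip: mult.assoc) (simp add: mult.assoc power_commutes)
  have vc: "v ^ i = c ^ i * c ^ i" for i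
    by (simp add: v power_mult_distrib power_add[symmetric] mult_2[symmetric] power_mult power2_eq_square)
  have adjv: "adj v = v" by (simp add: v adj_mult c)
  have pv: "nonneg (v ^ i)" for i
    unfolding vc by (intro nonneg_square) (simp add: adj_power c)
  have pd: "nonneg ((1 - v) * (1 - v) * v ^ i)" for i
  proof -
    have "(1 - v) * c ^ i = c ^ i * (1 - v)" by (simp add: algebra_simps cv)
    then have "((1 - v) * c ^ i) * ((1 - v) * c ^ i) = (1 - v) * (1 - v) * v ^ i"
      unfolding vc by (metis mult.assoc)
    moreover have "adj ((1 - v) * c ^ i) = (1 - v) * c ^ i"
      using \<open>(1 - v) * c ^ i = c ^ i * (1 - v)\<close> by (simp add: adj_mult adj_diff adjv adj_power c)
    ultimately show ?thesis using nonneg_square by metis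
  qed
  have "nonneg (E m)" for m
  proof (induction m)
    case 0 show ?case using nonneg_const[of 0] by (simp add: E_def)
  next
    case (Suc m)
    have "E (Suc m) = E m + real (Suc m) *\<^sub>R ((1 - v) * (1 - v) * v ^ m)"
      by (simp add: E_def algebra_simps scaleR_2)
    then show ?case using Suc pd by (simp add: nonneg_add nonneg_scaleR)
  qed
  from nonneg_add[OF this[of m] pv[of "Suc m"]] show ?thesis by (simp add: E_def)
qed

text \<open>With \<open>v = 1 - s\<close> and \<open>w = x v^k\<close> one has
  \<open>adj w * w = s v^(2k)\<close>, since an even power can be split between both sides.
  Kaplansky's estimate then turns the upper bound of \<open>nonneg_telescope\<close> into a norm
  bound. On a negative part of \<open>s\<close> the powers of \<open>1 - s\<close> would blow up;
  the bound excludes this.\<close>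

lemma norm_mult_power_one_minus_le:
  fixes x :: "'a::cstar_algebra_1"
  assumes s: "s = adj x * x" "norm s < 1"
  shows "norm (s * (1 - s) ^ (2 * k)) \<le> 1 / real (Suc (2 * k))"
proof -
  have sa: "adj s = s" by (simp add: s adj_mult)
  obtain c where c: "adj c = c" "c * c = 1 - s" using sqrt_one_minus[OF sa s(2)] by metis
  define v where "v = 1 - s"
  define w where "w = x * v ^ k"
  have adjv: "adj v = v" by (simp add: v_def adj_diff sa)
  have vs: "v ^ k * s = s * v ^ k"
    using power_commuting_commutes[of v s k] by (simp add: v_def algebra_simps)
  have "adj w * w = v ^ k * s * v ^ k"
    by (simp add: w_def adj_mult adj_power adjv s mult.assoc)
  also have "\<dots> = s * v ^ (2 * k)" by (simp add: vs mult.assoc mult_2 power_add)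
  finally have ww: "adj w * w = s * v ^ (2 * k)" .
  define N where "N = real (Suc (2 * k))"
  have N: "N > 0" by (simp add: N_def)
  have "nonneg (1 - N *\<^sub>R (s * v ^ (2 * k)))"
    using nonneg_telescope[OF c(1), of v "2 * k"] by (simp add: c v_def N_def)
  then have "nonneg (inverse N *\<^sub>R (1 - N *\<^sub>R (s * v ^ (2 * k))))"
    using N by (intro nonneg_scaleR) auto
  then have "nonneg (inverse N *\<^sub>R 1 - adj w * w)" using N by (simp add: ww scaleR_diff_right)
  then have "(norm w)\<^sup>2 \<le> inverse N" using N by (intro norm_square_le_of_nonneg) auto
  then show ?thesis
    using cstar_identity[of w] by (simp add: ww v_def N_def inverse_eq_divide)
qed

text \<open>This is the positivity of \<open>adj x * x\<close>. Since
  \<open>v * v = 1 - (1 + v) s\<close>, passing from \<open>v^(2k)\<close> to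
  \<open>v^(2k+2)\<close> raises the norm by at most \<open>1 + norm v\<close>; such linear growth
  of the powers of \<open>v * v\<close> forces \<open>norm (v * v) \<le> 1\<close>.\<close>

lemma norm_one_minus_adj_mult_self_le:
  fixes x :: "'a::cstar_algebra_1"
  assumes s: "s = adj x * x" "norm s < 1"
  shows "norm (1 - s) \<le> 1"
proof -
  define v where "v = 1 - s"
  have adjv: "adj v = v" by (simp add: v_def adj_diff adj_mult s)
  have step: "norm (v ^ (2 * Suc k)) \<le> norm (v ^ (2 * k)) + (1 + norm v)" for k
  proof -
    have "v ^ (2 * Suc k) = v ^ (2 * k) - (1 + v) * (s * v ^ (2 * k))"
      by (simp add: v_def algebra_simps mult_2 mult_2_right)
    moreover have "norm ((1 + v) * (s * v ^ (2 * k))) \<le> (1 + norm v) * 1"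
    proof (rule order_trans[OF norm_mult_ineq mult_mono])
      show "norm (1 + v) \<le> 1 + norm v" using norm_triangle_ineq[of 1 v] by simp
      show "norm (s * v ^ (2 * k)) \<le> 1"
        using norm_mult_power_one_minus_le[OF s, of k] unfolding v_def
        by (rule order_trans) (simp add: field_simps)
    qed auto
    ultimately show ?thesis
      using norm_triangle_ineq4[of "v ^ (2 * k)" "(1 + v) * (s * v ^ (2 * k))"] by simp
  qed
  have "norm ((v * v) ^ k) \<le> (1 + norm v) * real (Suc k) * 1 ^ k" for k
  proof -
    have "norm (v ^ (2 * k)) \<le> (1 + norm v) * real (Suc k)"
    proof (induction k)
      case (Suc k)
      then show ?case using step[of k] by (simp add: algebra_simps)
    qed simp
    then show ?thesis by (simp add: power_mult power2_eq_square)
  qed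
  then have "norm (v * v) \<le> 1"
    by (rule norm_le_of_power_growth[rotated -1]) (simp_all add: adj_mult adjv)
  then show ?thesis
    by (simp add: norm_square_selfadjoint[OF adjv] power_le_one_iff flip: v_def)
qed

text \<open>Anticommutation turns \<open>(1 + s)\<^sup>n s a\<close> into \<open>- a s (1 - s)\<^sup>n\<close>; the former has norm at least
  \<open>norm (s a)\<close> because \<open>s\<close> is nonnegative, the latter tends to \<open>0\<close>.\<close>

lemma anticommute_adj_mult_self_unital:
  fixes a x :: "'a::cstar_algebra_1"
  assumes anti: "a * (adj x * x) + (adj x * x) * a = 0"
  shows "(adj x * x) * a = 0"
proof -
  define t where "t = inverse (norm x + 1)"
  have "norm x + 1 > 0" by (simp add: add_nonneg_pos)
  then have t: "t > 0" by (simp add: t_def)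
  define y where "y = t *\<^sub>R x"
  define s where "s = adj y * y"
  have ny: "norm y < 1" using \<open>norm x + 1 > 0\<close> by (simp add: y_def t_def field_simps)
  have ns: "norm s < 1" using ny by (simp add: s_def cstar_identity power_less_one_iff)
  have s: "s = (t * t) *\<^sub>R (adj x * x)" by (simp add: s_def y_def adj_scaleR)
  have "a * s + s * a = (t * t) *\<^sub>R (a * (adj x * x) + (adj x * x) * a)"
    by (simp add: s scaleR_add_right)
  then have as: "s * a = - (a * s)" using anti by (simp add: eq_neg_iff_add_eq_0 add.commute)
  have shift: "(1 + s) ^ n * (s * a) = - (a * (s * (1 - s) ^ n))" for n
  proof (induction n)
    case 0 then show ?case by (simp add: as)
  next
    case (Suc n)
    have "(1 + s) * (a * (s * (1 - s) ^ n)) = a * ((1 - s) * (s * (1 - s) ^ n))"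
      using as by (simp add: algebra_simps flip: mult.assoc)
    also have "(1 - s) * (s * (1 - s) ^ n) = s * (1 - s) ^ Suc n" by (simp add: algebra_simps)
    finally show ?case using Suc by (simp add: mult.assoc)
  qed
  \<comment> \<open>From \<open>2 u = (1 + s) u + (1 - s) u\<close> and
    \<open>norm (1 - s) \<le> 1\<close>, multiplication by \<open>1 + s\<close> never shrinks a
    norm.\<close>
  have expand: "norm z \<le> norm ((1 + s) ^ n * z)" for z n
  proof (induction n)
    case (Suc n)
    define u where "u = (1 + s) ^ n * z"
    have "2 *\<^sub>R u = (1 + s) * u + (1 - s) * u" by (simp add: algebra_simps scaleR_2)
    then have "2 * norm u \<le> norm ((1 + s) * u) + norm ((1 - s) * u)"
      by (metis norm_scaleR abs_numeral norm_triangle_ineq)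
    also have "norm ((1 - s) * u) \<le> 1 * norm u"
      using norm_one_minus_adj_mult_self_le[OF s_def ns]
      by (intro order_trans[OF norm_mult_ineq] mult_right_mono) auto
    finally have "norm u \<le> norm ((1 + s) * u)" by simp
    then show ?case using Suc by (simp add: u_def mult.assoc)
  qed simp
  have bound: "norm (s * a) \<le> norm a * (1 / real (Suc (2 * k)))" for k
  proof -
    have "norm (s * a) \<le> norm (a * (s * (1 - s) ^ (2 * k)))"
      using expand[of "s * a" "2 * k"] by (simp add: shift)
    also have "\<dots> \<le> norm a * (1 / real (Suc (2 * k)))"
      by (intro order_trans[OF norm_mult_ineq] mult_left_mono norm_mult_power_one_minus_le[OF s_def ns]) simp
    finally show ?thesis .
  qed
  have "(\<lambda>k. norm a * (1 / real (Suc k))) \<longlonglongrightarrow> 0"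
    using tendsto_mult_left[OF LIMSEQ_inverse_real_of_nat, of "norm a"]
    by (simp add: inverse_eq_divide)
  then have "(\<lambda>k. norm a * (1 / real (Suc (2 * k)))) \<longlonglongrightarrow> 0"
    by (rule LIMSEQ_subseq_LIMSEQ[of _ _ "\<lambda>k. 2 * k", unfolded o_def]) (simp add: strict_mono_def)
  then have "norm (s * a) \<le> 0"
    by (rule tendsto_lowerbound) (use bound in auto)
  then have "s * a = 0" by simp
  then show ?thesis using t by (simp add: s)
qed

section \<open>Adjoining a unit\<close>

datatype 'a unitization = Adjoin (elem: 'a) (scalar: complex)

lemma unitization_eq_iff: "u = v \<longleftrightarrow> elem u = elem v \<and> scalar u = scalar v"
  by (cases u; cases v) simp

text \<open>Left multiplication by \<open>a + c 1\<close> on the original algebra, which is an ideal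
  of the unitization. Its operator norm is the source of the C*-norm.\<close>

definition act :: "'a::cstar_algebra unitization \<Rightarrow> 'a \<Rightarrow> 'a" where
  "act u z = elem u * z + scaleC (scalar u) z"

lemma bounded_linear_scaleC: "bounded_linear (scaleC c :: 'a::cstar_algebra \<Rightarrow> 'a)"
  by (rule bounded_linear_intro[where K = "cmod c"])
    (simp_all add: scaleC_add_right norm_scaleC scaleR_scaleC scaleC_scaleC mult.commute)

lemma bounded_linear_act: "bounded_linear (act u)"
  unfolding act_def
  by (intro bounded_linear_add bounded_linear_mult_right bounded_linear_scaleC)

text \<open>The maximum keeps the norm definite when \<open>'a\<close> already has a unit, in which case some
  nonzero element of the unitization acts as \<open>0\<close>.\<close>

instantiation unitization :: (cstar_algebra) real_normed_vector
begin

definition "0 = Adjoin 0 0"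
definition "u + v = Adjoin (elem u + elem v) (scalar u + scalar v)"
definition "u - v = Adjoin (elem u - elem v) (scalar u - scalar v)"
definition "- u = Adjoin (- elem u) (- scalar u)"
definition "r *\<^sub>R u = Adjoin (r *\<^sub>R elem u) (r *\<^sub>R scalar u)"
definition "norm u = max (onorm (act u)) (cmod (scalar u))"
definition "sgn u = inverse (norm u) *\<^sub>R (u :: 'a unitization)"
definition "dist u v = norm (u - v :: 'a unitization)"
definition [code del]:
  "(uniformity :: ('a unitization \<times> 'a unitization) filter) =
    (INF e\<in>{0 <..}. principal {(x, y). dist x y < e})"
definition [code del]:
  "open (U :: 'a unitization set) = (\<forall>x\<in>U. \<forall>\<^sub>F (x', y) in uniformity. x' = x \<longrightarrow> y \<in> U)"

instance
proof
  fix u v w :: "'a unitization" and r s :: real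
  note ops = zero_unitization_def plus_unitization_def minus_unitization_def
    uminus_unitization_def scaleR_unitization_def
  show "u + v + w = u + (v + w)" "u + v = v + u" "0 + u = u" "- u + u = 0" "u - v = u + - v"
    by (simp_all add: ops unitization_eq_iff algebra_simps)
  show "r *\<^sub>R (u + v) = r *\<^sub>R u + r *\<^sub>R v" "(r + s) *\<^sub>R u = r *\<^sub>R u + s *\<^sub>R u"
    "r *\<^sub>R s *\<^sub>R u = (r * s) *\<^sub>R u" "1 *\<^sub>R u = u"
    by (simp_all add: ops unitization_eq_iff algebra_simps)
  show "dist u v = norm (u - v)" by (rule dist_unitization_def)
  show "sgn u = inverse (norm u) *\<^sub>R u" by (rule sgn_unitization_def)
  show "uniformity = (INF e\<in>{0 <..}. principal {(x, y :: 'a unitization). dist x y < e})"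
    by (rule uniformity_unitization_def)
  show "open U = (\<forall>x\<in>U. \<forall>\<^sub>F (x', y) in uniformity. x' = x \<longrightarrow> y \<in> U)" for U :: "'a unitization set"
    by (rule open_unitization_def)
  have act_0: "act (0 :: 'a unitization) = (\<lambda>z. 0)"
    by (simp add: fun_eq_iff act_def ops scaleC_zero_left)
  show "norm u = 0 \<longleftrightarrow> u = 0"
  proof
    assume "norm u = 0"
    moreover have "onorm (act u) \<ge> 0" by (rule onorm_pos_le[OF bounded_linear_act])
    ultimately have "onorm (act u) = 0" "scalar u = 0"
      using norm_ge_zero[of "scalar u"] by (auto simp: norm_unitization_def max_def split: if_splits)
    then have "act u (adj (elem u)) = 0" by (simp add: onorm_eq_0[OF bounded_linear_act])
    then have "elem u * adj (elem u) = 0"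
      using \<open>scalar u = 0\<close> by (simp add: act_def scaleC_zero_left)
    then have "elem u = 0" by (rule mult_adj_self_eq_0)
    then show "u = 0" using \<open>scalar u = 0\<close> by (simp add: unitization_eq_iff ops)
  next
    assume u: "u = 0"
    have "onorm (act (0 :: 'a unitization)) = 0" unfolding act_0 by (rule onorm_zero)
    then show "norm u = 0" unfolding u norm_unitization_def by (simp add: ops)
  qed
  have "act (u + v) = (\<lambda>z. act u z + act v z)"
    by (simp add: fun_eq_iff act_def ops scaleC_add_left algebra_simps)
  then have "onorm (act (u + v)) \<le> onorm (act u) + onorm (act v)"
    using onorm_triangle[OF bounded_linear_act bounded_linear_act] by metis
  moreover have "cmod (scalar (u + v)) \<le> cmod (scalar u) + cmod (scalar v)"
    by (simp add: ops norm_triangle_ineq)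
  ultimately show "norm (u + v) \<le> norm u + norm v"
    by (auto simp: norm_unitization_def max_def)
  have "act (r *\<^sub>R u) = (\<lambda>z. r *\<^sub>R act u z)"
  proof
    fix z :: 'a
    have "scaleC (r *\<^sub>R scalar u) z = r *\<^sub>R scaleC (scalar u) z"
      by (simp only: scaleR_scaleC scaleC_scaleC scaleR_conv_of_real)
    then show "act (r *\<^sub>R u) z = r *\<^sub>R act u z"
      by (simp add: act_def ops scaleR_add_right)
  qed
  then have "onorm (act (r *\<^sub>R u)) = \<bar>r\<bar> * onorm (act u)"
    using onorm_scaleR[OF bounded_linear_act] by metis
  then show "norm (r *\<^sub>R u) = \<bar>r\<bar> * norm u"
    by (simp add: norm_unitization_def ops max_mult_distrib_left)
qed

end

lemma norm_act_le: "norm (act u z) \<le> norm u * norm z"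
  by (rule order_trans[OF onorm[OF bounded_linear_act]])
    (simp add: norm_unitization_def mult_right_mono)

lemma norm_scalar_le: "cmod (scalar u) \<le> norm u"
  by (simp add: norm_unitization_def)

lemma norm_unitization_le:
  assumes "\<And>z. norm (act u z) \<le> K * norm z" "cmod (scalar u) \<le> K"
  shows "norm u \<le> K"
  using assms onorm_bound[of K "act u"] order_trans[OF norm_ge_zero assms(2)]
  by (simp add: norm_unitization_def)

lemma norm_Adjoin_le: "norm (Adjoin a c) \<le> norm a + cmod c"
  by (rule norm_unitization_le)
    (auto simp: act_def norm_scaleC distrib_right intro!: norm_triangle_le add_right_mono norm_mult_ineq)

text \<open>Testing the action on \<open>adj a\<close> recovers \<open>a * adj a\<close> up to the
  scalar part, and each of the two terms costs one \<open>norm u\<close>. The bound makes the first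
  component of a Cauchy sequence Cauchy.\<close>

lemma norm_elem_le: "norm (elem u) \<le> 2 * norm u"
proof (cases "elem u = 0")
  case False
  define a where "a = elem u"
  have "norm a * norm a = norm (act u (adj a) - scaleC (scalar u) (adj a))"
    by (simp add: act_def a_def norm_mult_adj_self power2_eq_square)
  also have "\<dots> \<le> norm (act u (adj a)) + norm (scaleC (scalar u) (adj a))"
    by (rule norm_triangle_ineq4)
  also have "\<dots> \<le> norm u * norm a + norm u * norm a"
    using norm_act_le[of u "adj a"] mult_right_mono[OF norm_scalar_le[of u] norm_ge_zero[of a]]
    unfolding norm_scaleC norm_adj by (rule add_mono)
  also have "\<dots> = 2 * norm u * norm a" by simp
  finally show ?thesis using False by (simp add: a_def)
qed simp

instantiation unitization :: (cstar_algebra) cstar_algebra_1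
begin

definition "1 = Adjoin (0 :: 'a) 1"
definition "u * v = Adjoin (elem u * elem v + scaleC (scalar v) (elem u) + scaleC (scalar u) (elem v))
  (scalar u * scalar v)"
definition "scaleC c u = Adjoin (scaleC c (elem u)) (c * scalar u)"
definition "adj u = Adjoin (adj (elem u)) (cnj (scalar u))"

instance
proof
  fix u v w :: "'a unitization" and r :: real and c d :: complex
  note ops = zero_unitization_def plus_unitization_def minus_unitization_def
    uminus_unitization_def scaleR_unitization_def one_unitization_def times_unitization_def
    scaleC_unitization_def adj_unitization_def
  note scaleC = scaleC_add_right scaleC_add_left scaleC_scaleC scaleC_one scaleC_zero_left
    scaleC_zero_right mult_scaleC_left mult_scaleC_right scaleR_scaleC scaleR_conv_of_real
  show "u * v * w = u * (v * w)" "(u + v) * w = u * w + v * w" "u * (v + w) = u * v + u * w"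
    "1 * u = u" "u * 1 = u" "r *\<^sub>R u * v = r *\<^sub>R (u * v)" "u * r *\<^sub>R v = r *\<^sub>R (u * v)"
    by (simp_all add: ops unitization_eq_iff scaleC algebra_simps)
  show "(0 :: 'a unitization) \<noteq> 1" by (simp add: ops)
  show "scaleC c (u + v) = scaleC c u + scaleC c v" "scaleC (c + d) u = scaleC c u + scaleC d u"
    "scaleC c (scaleC d u) = scaleC (c * d) u" "scaleC 1 u = u" "r *\<^sub>R u = scaleC (complex_of_real r) u"
    "scaleC c u * v = scaleC c (u * v)" "u * scaleC c v = scaleC c (u * v)"
    by (simp_all add: ops unitization_eq_iff scaleC algebra_simps)
  show "adj (adj u) = u" "adj (u + v) = adj u + adj v" "adj (u * v) = adj v * adj u"
    "adj (scaleC c u) = scaleC (cnj c) (adj u)"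
    by (simp_all add: ops unitization_eq_iff adj_add adj_mult adj_scaleC algebra_simps)
  have le: "norm (scaleC c u) \<le> cmod c * norm u" for c and u :: "'a unitization"
  proof (rule norm_unitization_le)
    fix z
    have "act (scaleC c u) z = scaleC c (act u z)"
      by (simp add: act_def ops scaleC)
    then show "norm (act (scaleC c u) z) \<le> cmod c * norm u * norm z"
      using mult_left_mono[OF norm_act_le[of u z], of "cmod c"] by (simp add: norm_scaleC mult.assoc)
    show "cmod (scalar (scaleC c u)) \<le> cmod c * norm u"
      by (simp add: ops norm_mult mult_left_mono norm_scalar_le)
  qed
  show "norm (scaleC c u) = cmod c * norm u"
  proof (rule antisym[OF le])
    show "cmod c * norm u \<le> norm (scaleC c u)"
    proof (cases "c = 0")
      case False
      then have "scaleC (inverse c) (scaleC c u) = u"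
        by (simp add: ops unitization_eq_iff scaleC)
      then have "norm u \<le> inverse (cmod c) * norm (scaleC c u)"
        using le[of "inverse c" "scaleC c u"] by (simp add: norm_inverse)
      then show ?thesis using False by (simp add: field_simps)
    qed simp
  qed
  show norm_times: "norm (u * v) \<le> norm u * norm v" for u v :: "'a unitization"
  proof (rule norm_unitization_le)
    fix z
    have "norm (act (u * v) z) = norm (act u (act v z))"
      by (simp add: act_def ops scaleC algebra_simps)
    also have "\<dots> \<le> norm u * (norm v * norm z)"
      by (rule order_trans[OF norm_act_le mult_left_mono[OF norm_act_le]]) simp
    finally show "norm (act (u * v) z) \<le> norm u * norm v * norm z" by (simp add: mult.assoc)
    show "cmod (scalar (u * v)) \<le> norm u * norm v"
      by (simp add: ops norm_mult mult_mono norm_scalar_le)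
  qed
  show "norm (1 :: 'a unitization) = 1"
  proof (rule antisym)
    show "norm (1 :: 'a unitization) \<le> 1"
      by (rule norm_unitization_le) (simp_all add: act_def ops scaleC)
    show "1 \<le> norm (1 :: 'a unitization)"
      using norm_scalar_le[of "1 :: 'a unitization"] by (simp add: ops)
  qed
  \<comment> \<open>Only this half of the C*-identity is computed from the action; with
    submultiplicativity it yields that \<open>adj\<close> is isometric, and then equality.\<close>
  have square_le: "(norm u)\<^sup>2 \<le> norm (adj u * u)" for u :: "'a unitization"
  proof -
    define N where "N = norm (adj u * u)"
    have "norm u \<le> sqrt N"
    proof (rule norm_unitization_le)
      fix z
      have "adj (act u z) * act u z = adj z * act (adj u * u) z"
        by (simp add: act_def ops scaleC adj_add adj_mult adj_scaleC algebra_simps)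
      then have "(norm (act u z))\<^sup>2 = norm (adj z * act (adj u * u) z)"
        by (metis cstar_identity)
      also have "\<dots> \<le> norm z * (N * norm z)"
        unfolding N_def
        by (rule order_trans[OF norm_mult_ineq]) (simp add: norm_adj mult_left_mono norm_act_le)
      also have "\<dots> = (sqrt N * norm z)\<^sup>2" by (simp add: N_def power2_eq_square)
      finally show "norm (act u z) \<le> sqrt N * norm z"
        by (rule power2_le_imp_le) (simp add: N_def)
      have "(cmod (scalar u))\<^sup>2 = cmod (scalar (adj u * u))"
        by (simp add: ops norm_mult power2_eq_square)
      also have "\<dots> \<le> N" unfolding N_def by (rule norm_scalar_le)
      finally show "cmod (scalar u) \<le> sqrt N" by (rule real_le_rsqrt)
    qed
    then have "(norm u)\<^sup>2 \<le> (sqrt N)\<^sup>2" by (rule power_mono) simp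
    then show ?thesis by (simp add: N_def)
  qed
  have norm_le: "norm u \<le> norm (adj u)" for u :: "'a unitization"
  proof (cases "norm u = 0")
    case False
    have "norm u * norm u \<le> norm (adj u) * norm u"
      using square_le[of u] norm_times[of "adj u" u] by (simp add: power2_eq_square)
    then show ?thesis using False by (simp add: mult_le_cancel_right)
  qed simp
  have "norm (adj u) = norm u"
    using norm_le[of u] norm_le[of "adj u"] by (simp add: adj_unitization_def)
  then show "norm (adj u * u) = (norm u)\<^sup>2"
    using square_le[of u] norm_times[of "adj u" u] by (simp add: power2_eq_square)
  show "convergent X" if X: "Cauchy X" for X :: "nat \<Rightarrow> 'a unitization"
  proof -
    have "Cauchy (\<lambda>n. elem (X n))"
    proof (rule CauchyI)
      fix e :: real assume "e > 0"
      then obtain M where M: "\<And>m n. m \<ge> M \<Longrightarrow> n \<ge> M \<Longrightarrow> norm (X m - X n) < e / 2"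
        using CauchyD[OF X, of "e / 2"] by auto
      have "norm (elem (X m) - elem (X n)) < e" if "m \<ge> M" "n \<ge> M" for m n
        using M[OF that] norm_elem_le[of "X m - X n"] by (simp add: minus_unitization_def)
      then show "\<exists>M. \<forall>m\<ge>M. \<forall>n\<ge>M. norm (elem (X m) - elem (X n)) < e" by blast
    qed
    then obtain a where a: "(\<lambda>n. elem (X n)) \<longlonglongrightarrow> a" by (metis Cauchy_convergent_iff convergent_def)
    have "Cauchy (\<lambda>n. scalar (X n))"
    proof (rule CauchyI)
      fix e :: real assume "e > 0"
      then obtain M where M: "\<And>m n. m \<ge> M \<Longrightarrow> n \<ge> M \<Longrightarrow> norm (X m - X n) < e"
        using CauchyD[OF X] by blast
      have "cmod (scalar (X m) - scalar (X n)) < e" if "m \<ge> M" "n \<ge> M" for m n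
        using M[OF that] norm_scalar_le[of "X m - X n"] by (simp add: minus_unitization_def)
      then show "\<exists>M. \<forall>m\<ge>M. \<forall>n\<ge>M. cmod (scalar (X m) - scalar (X n)) < e" by blast
    qed
    then obtain c where c: "(\<lambda>n. scalar (X n)) \<longlonglongrightarrow> c" by (metis Cauchy_convergent_iff convergent_def)
    have "(\<lambda>n. norm (elem (X n) - a) + norm (scalar (X n) - c)) \<longlonglongrightarrow> 0 + 0"
      using a c by (intro tendsto_add) (simp_all add: tendsto_norm_zero LIM_zero)
    moreover have "norm (X n - Adjoin a c) \<le> norm (elem (X n) - a) + norm (scalar (X n) - c)" for n
      by (simp add: minus_unitization_def norm_Adjoin_le)
    ultimately have "(\<lambda>n. X n - Adjoin a c) \<longlonglongrightarrow> 0"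
      by (auto intro!: always_eventually elim!: tendsto_0_le[where K = 1])
    then have "X \<longlonglongrightarrow> Adjoin a c" by (rule LIM_zero_cancel)
    then show ?thesis by (rule convergentI)
  qed
qed

end

lemma anticommute_adj_mult_self:
  fixes a x :: "'a::cstar_algebra"
  assumes "a * (adj x * x) + (adj x * x) * a = 0"
  shows "(adj x * x) * a = 0" "a * (adj x * x) = 0"
proof -
  define e where "e b = Adjoin b 0" for b :: 'a
  have hom: "e (b * c) = e b * e c" "e (b + c) = e b + e c" "e (adj b) = adj (e b)" "e 0 = 0" for b c
    by (simp_all add: e_def times_unitization_def plus_unitization_def adj_unitization_def
        zero_unitization_def scaleC_zero_left)
  have "e a * (adj (e x) * e x) + (adj (e x) * e x) * e a = 0"
    using arg_cong[OF assms, of e] by (simp add: hom)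
  then have "e ((adj x * x) * a) = e 0"
    using anticommute_adj_mult_self_unital by (simp add: hom)
  then show "(adj x * x) * a = 0" by (simp add: e_def)
  then show "a * (adj x * x) = 0" using assms by simp
qed

section \<open>Annihilators\<close>

lemma cstar_subalgD:
  assumes "cstar_subalg B"
  shows "0 \<in> B" "x \<in> B \<Longrightarrow> y \<in> B \<Longrightarrow> x + y \<in> B" "x \<in> B \<Longrightarrow> y \<in> B \<Longrightarrow> x * y \<in> B"
    "x \<in> B \<Longrightarrow> scaleC c x \<in> B" "x \<in> B \<Longrightarrow> adj x \<in> B" "closed B"
  using assms by (auto simp: cstar_subalg_def)

lemma adj_mult_mult_eq_0:
  fixes a t :: "'a::cstar_algebra"
  assumes "adj t * t * a = 0"
  shows "t * a = 0"
  by (rule adj_mult_self_eq_0) (metis adj_mult assms mult.assoc mult_zero_right)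

lemma mult_mult_adj_eq_0:
  fixes a t :: "'a::cstar_algebra"
  assumes "a * (t * adj t) = 0"
  shows "a * t = 0"
  by (rule mult_adj_self_eq_0) (metis adj_mult assms mult.assoc mult_zero_left)

text \<open>The common feature of the sets whose complements are formed: sets of positive elements,
  subalgebras and unions of annihilators. It makes these complements C*-subalgebras.\<close>

definition star_closed :: "'a::cstar_algebra set \<Rightarrow> bool" where
  "star_closed S \<longleftrightarrow> (\<forall>s\<in>S. adj s \<in> S)"

definition perp :: "'a::cstar_algebra set \<Rightarrow> 'a set \<Rightarrow> 'a set" where
  "perp B S = {a \<in> B. \<forall>s\<in>S. a * s = 0 \<and> s * a = 0}"

lemma perpD: "a \<in> perp B S \<Longrightarrow> s \<in> S \<Longrightarrow> a * s = 0" "a \<in> perp B S \<Longrightarrow> s \<in> S \<Longrightarrow> s * a = 0"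
  by (auto simp: perp_def)

lemma perp_subset: "perp B S \<subseteq> B"
  by (auto simp: perp_def)

lemma perp_antimono: "S \<subseteq> T \<Longrightarrow> perp B T \<subseteq> perp B S"
  by (auto simp: perp_def)

lemma subset_perp_perp: "S \<subseteq> B \<Longrightarrow> S \<subseteq> perp B (perp B S)"
  by (auto simp: perp_def)

lemma perp_perp_perp: "S \<subseteq> B \<Longrightarrow> perp B (perp B (perp B S)) = perp B S"
  by (intro antisym perp_antimono subset_perp_perp perp_subset)

lemma star_closed_subalg: "cstar_subalg B \<Longrightarrow> star_closed B"
  by (simp add: star_closed_def cstar_subalgD)

lemma star_closed_Union: "(\<And>V. V \<in> F \<Longrightarrow> star_closed V) \<Longrightarrow> star_closed (\<Union>F)"
  by (auto simp: star_closed_def)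

lemma star_closed_perp:
  assumes "cstar_subalg B" "star_closed S"
  shows "star_closed (perp B S)"
  unfolding star_closed_def
proof
  fix a assume a: "a \<in> perp B S"
  have "adj a * s = 0 \<and> s * adj a = 0" if "s \<in> S" for s
  proof -
    have "adj s \<in> S" using that assms by (simp add: star_closed_def)
    then have "adj (adj s * a) = 0" "adj (a * adj s) = 0" using perpD[OF a] by simp_all
    then show ?thesis by (simp add: adj_mult)
  qed
  then show "adj a \<in> perp B S" using a assms(1) by (simp add: perp_def cstar_subalgD)
qed

lemma cstar_subalg_perp:
  assumes "cstar_subalg B" "star_closed S"
  shows "cstar_subalg (perp B S)"
proof -
  have "perp B S = B \<inter> {a. \<forall>s\<in>S. a * s = 0 \<and> s * a = 0}" by (auto simp: perp_def)
  moreover have "closed {a. \<forall>s\<in>S. a * s = 0 \<and> s * a = 0}"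
    unfolding Ball_def
    by (intro closed_Collect_all closed_Collect_imp closed_Collect_conj closed_Collect_eq
        continuous_intros) auto
  ultimately have "closed (perp B S)" using assms(1) by (simp add: closed_Int cstar_subalgD)
  moreover have "(a * b) * s = 0 \<and> s * (a * b) = 0"
    if "a \<in> perp B S" "b \<in> perp B S" "s \<in> S" for a b s
    using perpD[of a B S s] perpD[of b B S s] that by (metis mult.assoc mult_zero_left mult_zero_right)
  ultimately show ?thesis
    using assms star_closed_perp[OF assms]
    by (auto simp: cstar_subalg_def perp_def star_closed_def distrib_left distrib_right
        mult_scaleC_left mult_scaleC_right scaleC_zero_right)
qed

lemma Ann_eq_perp_of_pos:
  assumes "S \<subseteq> pos_part B"
  shows "Ann B S = perp B S"
proof -
  have "a * s = 0 \<and> s * a = 0" if as: "a * s + s * a = 0" and s: "s \<in> S" for a s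
  proof -
    obtain x where "s = adj x * x" using s assms by (auto simp: pos_part_def)
    then show ?thesis using anticommute_adj_mult_self[of a x] as by simp
  qed
  then have "Ann B S \<subseteq> perp B S" unfolding Ann_def perp_def by blast
  moreover have "perp B S \<subseteq> Ann B S" by (auto simp: Ann_def perp_def)
  ultimately show ?thesis by blast
qed

text \<open>The anticommutator lemma applies to \<open>adj t * t\<close> and
  \<open>t * adj t\<close>, and the C*-identity cancels the extra factor. The outer
  \<open>Ann\<close> in \<open>Ann B (Ann B S)\<close> calls for this form: its argument is a
  subalgebra, not a set of positive elements.\<close>

lemma Ann_eq_perp:
  assumes "star_closed T" "\<And>t. t \<in> T \<Longrightarrow> adj t * t \<in> T"
  shows "Ann B T = perp B T"
proof -
  have "a * t = 0 \<and> t * a = 0" if a: "\<forall>s\<in>T. a * s + s * a = 0" and t: "t \<in> T" for a t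
  proof
    have "adj t \<in> T" using assms(1) t by (simp add: star_closed_def)
    then have "a * (t * adj t) + (t * adj t) * a = 0" using a assms(2)[of "adj t"] by simp
    then have "a * (t * adj t) = 0" using anticommute_adj_mult_self(2)[of a "adj t"] by simp
    then show "a * t = 0" by (rule mult_mult_adj_eq_0)
    have "a * (adj t * t) + (adj t * t) * a = 0" using a assms(2) t by simp
    then have "adj t * t * a = 0" by (rule anticommute_adj_mult_self(1))
    then show "t * a = 0" by (rule adj_mult_mult_eq_0)
  qed
  then have "Ann B T \<subseteq> perp B T" unfolding Ann_def perp_def by blast
  moreover have "perp B T \<subseteq> Ann B T" by (auto simp: Ann_def perp_def)
  ultimately show ?thesis by blast
qed

lemma Ann_subalg: "cstar_subalg T \<Longrightarrow> Ann B T = perp B T"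
  by (rule Ann_eq_perp) (simp_all add: star_closed_def cstar_subalgD)

lemma star_closed_pos_part: "S \<subseteq> pos_part B \<Longrightarrow> star_closed S"
  by (auto simp: star_closed_def pos_part_def adj_mult dest!: subsetD)

lemma pos_part_subset: "cstar_subalg B \<Longrightarrow> pos_part B \<subseteq> B"
  by (auto simp: pos_part_def cstar_subalgD)

lemma Ann_Ann:
  assumes "cstar_subalg B" "S \<subseteq> pos_part B"
  shows "Ann B S = perp B S" "Ann B (Ann B S) = perp B (perp B S)"
  using Ann_eq_perp_of_pos[OF assms(2)] assms
  by (auto simp: Ann_subalg cstar_subalg_perp star_closed_pos_part)

text \<open>For \<open>V = perp B T\<close> the positive elements of \<open>V\<close> serve as
  generating set: whatever is orthogonal to \<open>v * adj v\<close> and \<open>adj v * v\<close> is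
  orthogonal to \<open>v\<close>, so \<open>pos_part V\<close> and \<open>V\<close> have the same
  complement.\<close>

lemma annihilators_iff:
  assumes B: "cstar_subalg B"
  shows "V \<in> annihilators B \<longleftrightarrow> (\<exists>T\<subseteq>B. star_closed T \<and> V = perp B T)"
proof
  assume "V \<in> annihilators B"
  then obtain S where S: "S \<subseteq> pos_part B" "V = Ann B (Ann B S)" by (auto simp: annihilators_def)
  then show "\<exists>T\<subseteq>B. star_closed T \<and> V = perp B T"
    using Ann_Ann[OF B] star_closed_perp[OF B star_closed_pos_part] perp_subset by metis
next
  assume "\<exists>T\<subseteq>B. star_closed T \<and> V = perp B T"
  then obtain T where T: "T \<subseteq> B" "star_closed T" "V = perp B T" by blast
  have V: "cstar_subalg V" "V \<subseteq> B" using T B by (simp_all add: cstar_subalg_perp perp_subset)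
  have pos: "pos_part V \<subseteq> pos_part B" using V(2) by (auto simp: pos_part_def)
  have "a * v = 0 \<and> v * a = 0" if a: "a \<in> perp B (pos_part V)" and v: "v \<in> V" for a v
  proof
    have "v * adj v \<in> pos_part V"
      using v V(1) by (auto simp: pos_part_def cstar_subalgD intro!: bexI[of _ "adj v"])
    then show "a * v = 0" using perpD(1)[OF a] mult_mult_adj_eq_0 by blast
    have "adj v * v \<in> pos_part V" using v by (auto simp: pos_part_def)
    then show "v * a = 0" using perpD(2)[OF a] adj_mult_mult_eq_0 by blast
  qed
  then have "perp B (pos_part V) \<subseteq> perp B V"
    using perp_subset[of B "pos_part V"] unfolding perp_def[of B V] by blast
  then have "perp B (pos_part V) = perp B V"
    using perp_antimono[OF pos_part_subset[OF V(1)]] by blast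
  then have "Ann B (Ann B (pos_part V)) = V"
    using Ann_Ann(2)[OF B pos] T perp_perp_perp by metis
  then show "V \<in> annihilators B" using pos by (auto simp: annihilators_def)
qed

lemma perp_in_annihilators:
  "cstar_subalg B \<Longrightarrow> T \<subseteq> B \<Longrightarrow> star_closed T \<Longrightarrow> perp B T \<in> annihilators B"
  using annihilators_iff by blast

lemma annihilatorsD:
  assumes "cstar_subalg B" "V \<in> annihilators B"
  shows "V \<subseteq> B" "cstar_subalg V" "star_closed V" "perp B (perp B V) = V" "perp B V \<in> annihilators B"
proof -
  obtain T where T: "T \<subseteq> B" "star_closed T" "V = perp B T"
    using annihilators_iff[OF assms(1)] assms(2) by blast
  show "V \<subseteq> B" "cstar_subalg V" "perp B (perp B V) = V"
    using T assms(1) by (simp_all add: perp_subset cstar_subalg_perp perp_perp_perp)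
  then show "star_closed V" "perp B V \<in> annihilators B"
    using assms(1) by (simp_all add: star_closed_subalg perp_in_annihilators)
qed

text \<open>What remains of the ideal property when an annihilator is not central.\<close>

lemma annihilator_hereditary:
  assumes "cstar_subalg B" "V \<in> annihilators B" "v \<in> V" "b \<in> B" "w \<in> V"
  shows "v * b * w \<in> V"
proof -
  have "v * b * w \<in> perp B (perp B V)"
    unfolding perp_def[of B "perp B V"]
  proof (intro CollectI conjI ballI)
    show "v * b * w \<in> B"
      using assms(3-5) annihilatorsD(1)[OF assms(1,2)] by (auto intro!: cstar_subalgD[OF assms(1)])
    fix s assume s: "s \<in> perp B V"
    show "v * b * w * s = 0" using perpD(2)[OF s assms(5)] by (simp add: mult.assoc)
    show "s * (v * b * w) = 0" using perpD(1)[OF s assms(3)] by (simp flip: mult.assoc)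
  qed
  then show ?thesis using annihilatorsD(4)[OF assms(1,2)] by simp
qed

lemma mem_perp_self:
  assumes "star_closed V" "x \<in> V" "x \<in> perp B V"
  shows "x = 0"
  using assms perpD(1)[of x B V "adj x"] by (auto simp: star_closed_def intro: mult_adj_self_eq_0)

section \<open>Lattice operations on annihilators\<close>

lemma Int_Inter_eq_perp:
  assumes "cstar_subalg B" "F \<subseteq> annihilators B"
  shows "B \<inter> \<Inter>F = perp B (\<Union>(perp B ` F))"
proof -
  have "V = perp B (perp B V)" if "V \<in> F" for V
    using annihilatorsD(4)[of B V] assms that by auto
  then have "B \<inter> \<Inter>F = B \<inter> (\<Inter>V\<in>F. perp B (perp B V))" by (simp cong: INF_cong)
  also have "\<dots> = perp B (\<Union>(perp B ` F))" unfolding perp_def[of B "\<Union>(perp B ` F)"]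
    unfolding perp_def[of B "perp B _"] by blast
  finally show ?thesis .
qed

lemma Int_Inter_in_annihilators:
  assumes "cstar_subalg B" "F \<subseteq> annihilators B"
  shows "B \<inter> \<Inter>F \<in> annihilators B"
  unfolding Int_Inter_eq_perp[OF assms]
proof (rule perp_in_annihilators[OF assms(1)])
  show "\<Union>(perp B ` F) \<subseteq> B" using perp_subset by blast
  show "star_closed (\<Union>(perp B ` F))"
    using annihilatorsD(3)[OF assms(1)] assms(2)
    by (intro star_closed_Union) (auto intro!: star_closed_perp[OF assms(1)])
qed

lemma Int_in_annihilators:
  assumes "cstar_subalg B" "X \<in> annihilators B" "Y \<in> annihilators B"
  shows "X \<inter> Y \<in> annihilators B"
  using Int_Inter_in_annihilators[OF assms(1), of "{X, Y}"] assms annihilatorsD(1)[OF assms(1)]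
  by (simp add: Int_absorb1 flip: Int_assoc)

lemma Union_annihilators:
  assumes "cstar_subalg B" "F \<subseteq> annihilators B"
  shows "\<Union>F \<subseteq> B" "star_closed (\<Union>F)"
  using assms annihilatorsD(1,3) by (auto intro!: star_closed_Union) blast+

text \<open>Infima are plain intersections; the factor \<open>B\<close> accounts for the empty
  family, whose intersection is the whole type.\<close>

lemma is_glb_P_iff:
  assumes "cstar_subalg B" "F \<subseteq> annihilators B"
  shows "is_glb_P B F W \<longleftrightarrow> W = B \<inter> \<Inter>F"
proof -
  have W: "B \<inter> \<Inter>F \<in> annihilators B" by (rule Int_Inter_in_annihilators[OF assms])
  have least: "U \<subseteq> B \<inter> \<Inter>F" if "U \<in> annihilators B" "\<forall>V\<in>F. U \<subseteq> V" for U
    using annihilatorsD(1)[OF assms(1) that(1)] that(2) by blast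
  show ?thesis
  proof
    assume "is_glb_P B F W"
    then have "W \<subseteq> B \<inter> \<Inter>F" "B \<inter> \<Inter>F \<subseteq> W"
      using least W unfolding is_glb_P_def by (blast, meson Inf_lower inf.coboundedI2)
    then show "W = B \<inter> \<Inter>F" by (rule antisym)
  next
    assume "W = B \<inter> \<Inter>F"
    then show "is_glb_P B F W" using least W unfolding is_glb_P_def by blast
  qed
qed

lemma is_lub_P_iff:
  assumes "cstar_subalg B" "F \<subseteq> annihilators B"
  shows "is_lub_P B F W \<longleftrightarrow> W = perp B (perp B (\<Union>F))"
proof -
  let ?W = "perp B (perp B (\<Union>F))"
  note U = Union_annihilators[OF assms]
  have W: "?W \<in> annihilators B"
    using assms(1) U by (intro perp_in_annihilators star_closed_perp perp_subset)
  have upper: "V \<subseteq> ?W" if "V \<in> F" for V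
    using subset_perp_perp[OF U(1)] that by blast
  have least: "?W \<subseteq> U" if "U \<in> annihilators B" "\<forall>V\<in>F. V \<subseteq> U" for U
  proof -
    have "?W \<subseteq> perp B (perp B U)" using that(2) by (intro perp_antimono) blast
    then show ?thesis using annihilatorsD(4)[OF assms(1) that(1)] by simp
  qed
  show ?thesis
  proof
    assume "is_lub_P B F W"
    then have "W \<subseteq> ?W" "?W \<subseteq> W" using W upper least unfolding is_lub_P_def by (blast, meson)
    then show "W = ?W" by (rule antisym)
  next
    assume "W = ?W"
    then show "is_lub_P B F W" using W upper least unfolding is_lub_P_def by blast
  qed
qed

lemma inf_P_eq:
  assumes "cstar_subalg B" "X \<in> annihilators B" "Y \<in> annihilators B"
  shows "inf_P B X Y = X \<inter> Y"
  using is_glb_P_iff[OF assms(1), of "{X, Y}"] assms annihilatorsD(1)[OF assms(1)]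
  unfolding inf_P_def by (intro the_equality) (simp_all add: Int_absorb1 flip: Int_assoc)

lemma sup_P_eq:
  assumes "cstar_subalg B" "X \<in> annihilators B" "Y \<in> annihilators B"
  shows "sup_P B X Y = perp B (perp B (X \<union> Y))"
  using is_lub_P_iff[OF assms(1), of "{X, Y}"] assms unfolding sup_P_def by (intro the_equality) simp_all

section \<open>Central annihilators\<close>

text \<open>The condition on \<open>dset\<close> forbids nonzero products \<open>v * b * w\<close>
  linking \<open>V\<close> with its complement, which makes \<open>V\<close> an ideal. Conversely,
  for an ideal the set \<open>dset\<close> lies in the complement, and \<open>perp B V\<close> meets
  its own complement only in 0.\<close>

lemma central_ann_iff:
  assumes B: "cstar_subalg B"
  shows "V \<in> central_ann B \<longleftrightarrow>
    V \<in> annihilators B \<and> (\<forall>v\<in>V. \<forall>b\<in>B. v * b \<in> V \<and> b * v \<in> V)"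
proof
  assume "V \<in> central_ann B"
  then obtain S where S: "S \<subseteq> pos_part B" "V = Ann B (Ann B S)"
    and disj: "dset B (Ann B (Ann B S)) \<inter> dset B (Ann B S) = {0}"
    by (auto simp: central_ann_def)
  have V: "V \<in> annihilators B" using S by (auto simp: annihilators_def)
  have "S \<subseteq> B" using S(1) pos_part_subset[OF B] by blast
  then have "Ann B S = perp B V" using S Ann_Ann[OF B S(1)] perp_perp_perp by metis
  then have disj: "dset B V \<inter> dset B (perp B V) = {0}" using disj S(2) by simp
  note VB = annihilatorsD[OF B V]
  \<comment> \<open>Between two factors from \<open>V\<close> the right one annihilates
    \<open>w\<close>; between two from \<open>perp B V\<close> the left one annihilates
    \<open>v\<close>. So the product lies in both sets \<open>dset\<close>.\<close>
  have vbw: "v * b * w = 0" if "v \<in> V" "b \<in> B" "w \<in> perp B V" for v b w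
  proof -
    have "v * b * w \<in> B"
      using that VB(1) perp_subset[of B V] by (auto intro!: cstar_subalgD(3)[OF B])
    moreover have "x * (v * b * w) * y = 0" if "y \<in> V" for x y
      using perpD(1)[OF \<open>w \<in> perp B V\<close> that] by (simp add: mult.assoc)
    moreover have "x * (v * b * w) * y = 0" if "x \<in> perp B V" for x y
      using perpD(1)[OF that \<open>v \<in> V\<close>] by (simp flip: mult.assoc)
    ultimately have "v * b * w \<in> dset B V \<inter> dset B (perp B V)" by (simp add: dset_def)
    then show ?thesis using disj by simp
  qed
  have vb: "v * b \<in> V" if "v \<in> V" "b \<in> B" for v b
  proof -
    have "v * b \<in> perp B (perp B V)"
      unfolding perp_def[of B "perp B V"]
    proof (intro CollectI conjI ballI)
      show "v * b \<in> B" using that VB(1) by (auto intro!: cstar_subalgD(3)[OF B])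
      fix s assume s: "s \<in> perp B V"
      show "v * b * s = 0" using vbw[OF that s] .
      show "s * (v * b) = 0" using perpD(1)[OF s that(1)] by (simp flip: mult.assoc)
    qed
    then show ?thesis using VB(4) by simp
  qed
  moreover have "b * v \<in> V" if "v \<in> V" "b \<in> B" for v b
  proof -
    have "adj v * adj b \<in> V" using that VB(2) B by (intro vb) (simp_all add: cstar_subalgD)
    then have "adj (adj v * adj b) \<in> V" using VB(2) by (simp add: cstar_subalgD)
    then show ?thesis by (simp add: adj_mult)
  qed
  ultimately show "V \<in> annihilators B \<and> (\<forall>v\<in>V. \<forall>b\<in>B. v * b \<in> V \<and> b * v \<in> V)" using V by blast
next
  assume ideal: "V \<in> annihilators B \<and> (\<forall>v\<in>V. \<forall>b\<in>B. v * b \<in> V \<and> b * v \<in> V)"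
  then have V: "V \<in> annihilators B" by simp
  note VB = annihilatorsD[OF B V]
  obtain S where S: "S \<subseteq> pos_part B" "V = Ann B (Ann B S)"
    using V by (auto simp: annihilators_def)
  have "S \<subseteq> B" using S(1) pos_part_subset[OF B] by blast
  then have T: "Ann B S = perp B V" using S Ann_Ann[OF B S(1)] perp_perp_perp by metis
  have ideal_perp: "b * w \<in> perp B V" "w * b \<in> perp B V" if "w \<in> perp B V" "b \<in> B" for w b
  proof -
    have "b * w \<in> B" "w * b \<in> B" using that perp_subset[of B V] by (auto intro!: cstar_subalgD(3)[OF B])
    moreover have "b * w * v = 0 \<and> v * (b * w) = 0 \<and> w * b * v = 0 \<and> v * (w * b) = 0"
      if "v \<in> V" for v
      using perpD[OF \<open>w \<in> perp B V\<close>] that ideal \<open>b \<in> B\<close> by (metis mult.assoc mult_zero_left mult_zero_right)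
    ultimately show "b * w \<in> perp B V" "w * b \<in> perp B V" by (auto simp: perp_def)
  qed
  have orth: "a \<in> perp B I" if a: "a \<in> dset B I" and I: "cstar_subalg I"
    "\<And>v b. v \<in> I \<Longrightarrow> b \<in> B \<Longrightarrow> v * b \<in> I \<and> b * v \<in> I" for a I
  proof -
    have aB: "a \<in> B" using a by (simp add: dset_def)
    have yay: "y * a * y = 0" if "y \<in> I" for y
    proof -
      have "2 *\<^sub>R (y * a * y) = y * a * y + y * a * y" by (rule scaleR_2)
      also have "\<dots> = 0" using a that by (simp add: dset_def)
      finally show ?thesis by simp
    qed
    have ua: "u * a = 0" if "u \<in> I" for u
    proof -
      \<comment> \<open>For \<open>y = adj a * (adj u * u)\<close> in the ideal,
        \<open>y * a * y = 0\<close> times \<open>a\<close> gives \<open>k * k = 0\<close>, and a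
        self-adjoint element of square zero vanishes.\<close>
      define k where "k = adj a * (adj u * u) * a"
      have "adj a * (adj u * u) \<in> I" using that I aB B by (simp add: cstar_subalgD)
      then have "adj a * (adj u * u) * a * (adj a * (adj u * u)) = 0" by (rule yay)
      then have "k * k = 0" unfolding k_def by (metis mult.assoc mult_zero_left)
      moreover have "adj k = k" by (simp add: k_def adj_mult mult.assoc)
      ultimately have "k = 0" using adj_mult_self_eq_0 by metis
      then have "adj (u * a) * (u * a) = 0" by (simp add: k_def adj_mult mult.assoc)
      then show ?thesis by (rule adj_mult_self_eq_0)
    qed
    have au: "a * u = 0" if "u \<in> I" for u
    proof -
      define k where "k = a * (u * adj u) * adj a"
      have "u * adj u * adj a \<in> I" using that I aB B by (simp add: cstar_subalgD)
      then have "u * adj u * adj a * a * (u * adj u * adj a) = 0" by (rule yay)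
      then have "k * k = 0" unfolding k_def by (metis mult.assoc mult_zero_right)
      moreover have "adj k = k" by (simp add: k_def adj_mult mult.assoc)
      ultimately have "k = 0" using adj_mult_self_eq_0 by metis
      then have "a * u * adj (a * u) = 0" by (simp add: k_def adj_mult mult.assoc)
      then show ?thesis by (rule mult_adj_self_eq_0)
    qed
    show ?thesis using ua au aB by (simp add: perp_def)
  qed
  have P: "cstar_subalg (perp B V)" using annihilatorsD(2)[OF B VB(5)] .
  have "a = 0" if "a \<in> dset B V" "a \<in> dset B (perp B V)" for a
  proof (rule mem_perp_self[OF star_closed_subalg[OF P]])
    show "a \<in> perp B V" using that(1) VB(2) ideal by (intro orth) auto
    show "a \<in> perp B (perp B V)" using that(2) P ideal_perp by (intro orth) auto
  qed
  moreover have "0 \<in> dset B V \<inter> dset B (perp B V)" by (simp add: dset_def cstar_subalgD[OF B])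
  ultimately have "dset B V \<inter> dset B (perp B V) = {0}" by blast
  then have "dset B (Ann B (Ann B S)) \<inter> dset B (Ann B S) = {0}"
    by (subst S(2)[symmetric]) (subst T)
  then show "V \<in> central_ann B" using S unfolding central_ann_def by blast
qed

lemma central_annD:
  assumes "cstar_subalg B" "Z \<in> central_ann B"
  shows "Z \<in> annihilators B" "v \<in> Z \<Longrightarrow> b \<in> B \<Longrightarrow> v * b \<in> Z" "v \<in> Z \<Longrightarrow> b \<in> B \<Longrightarrow> b * v \<in> Z"
    "cstar_subalg Z" "Z \<subseteq> B"
  using assms central_ann_iff annihilatorsD by blast+

lemma central_perp:
  assumes B: "cstar_subalg B" and Z: "Z \<in> central_ann B"
  shows "perp B Z \<in> central_ann B"
proof -
  note ZB = central_annD[OF B Z]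
  have "b * w \<in> perp B Z \<and> w * b \<in> perp B Z" if "w \<in> perp B Z" "b \<in> B" for w b
  proof -
    have "b * w \<in> B" "w * b \<in> B" using that perp_subset[of B Z] by (auto intro!: cstar_subalgD(3)[OF B])
    moreover have "b * w * v = 0 \<and> v * (b * w) = 0 \<and> w * b * v = 0 \<and> v * (w * b) = 0"
      if "v \<in> Z" for v
      using perpD[OF \<open>w \<in> perp B Z\<close>] that ZB(2,3) \<open>b \<in> B\<close>
      by (metis mult.assoc mult_zero_left mult_zero_right)
    ultimately show ?thesis by (auto simp: perp_def)
  qed
  then show ?thesis using central_ann_iff[OF B] annihilatorsD(5)[OF B ZB(1)] by blast
qed

lemma central_Int_Inter:
  assumes B: "cstar_subalg B" and F: "F \<subseteq> central_ann B"
  shows "B \<inter> \<Inter>F \<in> central_ann B"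
proof -
  have "F \<subseteq> annihilators B" using F central_annD(1)[OF B] by blast
  then show ?thesis
    using Int_Inter_in_annihilators[OF B] F central_annD(2,3)[OF B] B
    by (auto simp: central_ann_iff[OF B] cstar_subalgD)
qed

lemma central_perp_Union:
  assumes B: "cstar_subalg B" and F: "F \<subseteq> central_ann B"
  shows "perp B (\<Union>F) \<in> central_ann B"
proof -
  have "perp B (\<Union>F) = B \<inter> \<Inter>(perp B ` F)" by (auto simp: perp_def)
  then show ?thesis using central_Int_Inter[OF B, of "perp B ` F"] central_perp[OF B] F by auto
qed

lemma central_support:
  assumes B: "cstar_subalg B" and V: "V \<in> annihilators B"
  shows "central_support B V \<in> central_ann B" "V \<subseteq> central_support B V"
    "Z \<in> central_ann B \<Longrightarrow> V \<subseteq> Z \<Longrightarrow> central_support B V \<subseteq> Z"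
proof -
  let ?F = "{Z \<in> central_ann B. V \<subseteq> Z}"
  have "?F \<subseteq> annihilators B" using central_annD(1)[OF B] by blast
  then have eq: "central_support B V = B \<inter> \<Inter>?F"
    unfolding central_support_def using is_glb_P_iff[OF B] by (intro the_equality) simp_all
  show "central_support B V \<in> central_ann B"
    unfolding eq by (rule central_Int_Inter[OF B]) blast
  show "V \<subseteq> central_support B V" unfolding eq using annihilatorsD(1)[OF B V] by blast
  show "Z \<in> central_ann B \<Longrightarrow> V \<subseteq> Z \<Longrightarrow> central_support B V \<subseteq> Z" unfolding eq by blast
qed

section \<open>Annihilators computed inside other annihilators\<close>

lemma annihilators_annihilator:
  assumes B: "cstar_subalg B" and V: "V \<in> annihilators B" and W: "W \<in> annihilators V"
  shows "W \<in> annihilators B"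
proof -
  note VB = annihilatorsD[OF B V]
  obtain T where T: "T \<subseteq> V" "star_closed T" "W = perp V T"
    using annihilators_iff[OF VB(2)] W by blast
  have "W = V \<inter> perp B T" using T(3) VB(1) by (auto simp: perp_def)
  then show ?thesis using T VB B V by (auto intro!: Int_in_annihilators perp_in_annihilators)
qed

text \<open>For \<open>W \<subseteq> Z\<close>, the double complement of \<open>W\<close> inside \<open>Z\<close> is no larger than the one in \<open>B\<close>: if
  \<open>t\<close> is orthogonal to \<open>W\<close>, then \<open>t Z t*\<close> lies in \<open>Z\<close> and is orthogonal to \<open>W\<close>.\<close>

lemma annihilators_central:
  assumes B: "cstar_subalg B" and Z: "Z \<in> central_ann B"
  shows "annihilators Z = {V \<in> annihilators B. V \<subseteq> Z}"
proof (intro equalityI subsetI)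
  note ZB = central_annD[OF B Z]
  fix W
  show "W \<in> {V \<in> annihilators B. V \<subseteq> Z}" if "W \<in> annihilators Z"
    using annihilators_annihilator[OF B ZB(1) that] annihilatorsD(1)[OF ZB(4) that] by simp
next
  note ZB = central_annD[OF B Z]
  fix W
  assume "W \<in> {V \<in> annihilators B. V \<subseteq> Z}"
  then have W: "W \<in> annihilators B" "W \<subseteq> Z" by auto
  note WB = annihilatorsD[OF B W(1)]
  have zt: "z * t = 0" if z: "z \<in> perp Z (perp Z W)" and t: "t \<in> perp B W" for z t
  proof -
    define g where "g = z * t"
    have tB: "t \<in> B" "adj t \<in> B" using t perp_subset[of B W] B by (auto simp: cstar_subalgD)
    have at: "adj t \<in> perp B W" using t star_closed_perp[OF B WB(3)] by (simp add: star_closed_def)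
    have zZ: "z \<in> Z" using z perp_subset by blast
    have gZ: "g \<in> Z" "adj g \<in> Z" using zZ tB ZB by (auto simp: g_def cstar_subalgD)
    have "t * (adj g * g) * adj t \<in> Z"
      using gZ tB ZB by (simp add: cstar_subalgD)
    moreover have "t * (adj g * g) * adj t * s = 0 \<and> s * (t * (adj g * g) * adj t) = 0" if "s \<in> W" for s
      using perpD(1)[OF at that] perpD(2)[OF t that] by (simp add: mult.assoc) (simp flip: mult.assoc)
    ultimately have "t * (adj g * g) * adj t \<in> perp Z W" by (simp add: perp_def)
    then have "z * (t * (adj g * g) * adj t) = 0" using perpD(1)[OF z] by blast
    then have "z * (t * (adj g * g) * adj t) * adj z = 0" by simp
    then have "g * adj g * (g * adj g) = 0" by (simp add: g_def adj_mult mult.assoc)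
    then have "adj (g * adj g) * (g * adj g) = 0" by (simp add: adj_mult)
    then have "g * adj g = 0" by (rule adj_mult_self_eq_0)
    then show ?thesis unfolding g_def[symmetric] by (rule mult_adj_self_eq_0)
  qed
  have sc: "star_closed (perp Z (perp Z W))"
    using ZB(4) WB(3) by (intro star_closed_perp)
  have tz: "t * z = 0" if z: "z \<in> perp Z (perp Z W)" and t: "t \<in> perp B W" for z t
  proof -
    have "adj z * adj t = 0"
      using sc z t star_closed_perp[OF B WB(3)] by (intro zt) (simp_all add: star_closed_def)
    then have "adj (t * z) = 0" by (simp add: adj_mult)
    then show ?thesis using adj_adj adj_zero by metis
  qed
  have "perp Z (perp Z W) \<subseteq> perp B (perp B W)"
    using zt tz ZB(5) perp_subset[of Z "perp Z W"] unfolding perp_def[of B "perp B W"] by blast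
  then have "perp Z (perp Z W) = W"
    using WB(4) subset_perp_perp[OF W(2)] by auto
  then show "W \<in> annihilators Z"
    using perp_in_annihilators[OF ZB(4) perp_subset star_closed_perp[OF ZB(4) WB(3)]] by metis
qed

text \<open>A central annihilator of \<open>Z\<close> is at first an ideal of \<open>Z\<close> only.
  That it is an ideal of \<open>B\<close> is the transitivity known for closed ideals, obtained here
  from triple products in place of approximate units.\<close>

lemma central_ann_central:
  assumes B: "cstar_subalg B" and Z: "Z \<in> central_ann B"
  shows "central_ann Z = {V \<in> central_ann B. V \<subseteq> Z}"
proof (intro equalityI subsetI)
  note ZB = central_annD[OF B Z]
  fix V
  show "V \<in> central_ann Z" if "V \<in> {V \<in> central_ann B. V \<subseteq> Z}"
    using that annihilators_central[OF B Z] ZB(5)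
    unfolding mem_Collect_eq central_ann_iff[OF B] central_ann_iff[OF ZB(4)] by blast
next
  note ZB = central_annD[OF B Z]
  fix V
  assume V: "V \<in> central_ann Z"
  note VZ = central_annD[OF ZB(4) V]
  have VB: "V \<in> annihilators B" using VZ(1) annihilators_central[OF B Z] by blast
  have vb: "v * b \<in> V" if v: "v \<in> V" and b: "b \<in> B" for v b
  proof -
    have "v * b \<in> perp Z (perp Z V)"
      unfolding perp_def[of Z "perp Z V"]
    proof (intro CollectI conjI ballI)
      show "v * b \<in> Z" using VZ(5) v b ZB(2) by blast
      fix w assume w: "w \<in> perp Z V"
      show "w * (v * b) = 0" using perpD(1)[OF w v] by (simp flip: mult.assoc)
      define g where "g = v * b * w"
      have "w \<in> Z" "v \<in> Z" using w perp_subset VZ(5) v by blast+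
      then have "g \<in> Z" using ZB b by (simp add: g_def cstar_subalgD)
      \<comment> \<open>With \<open>v\<close> on its left and \<open>w\<close> on its right this
        element becomes \<open>g * adj g * g\<close>; as it lies in \<open>Z\<close>, its product
        with \<open>v\<close> lies in \<open>V\<close>, which \<open>w\<close> annihilates.\<close>
      then have "b * w * adj g * v * b \<in> Z"
        using ZB b \<open>w \<in> Z\<close> \<open>v \<in> Z\<close> by (simp add: cstar_subalgD)
      then have "v * (b * w * adj g * v * b) * w = 0"
        using VZ(2)[OF v] perpD(2)[OF w] by blast
      then have "g * adj g * g = 0" by (simp add: g_def mult.assoc)
      then have "adj (g * adj g) * (g * adj g) = 0" by (simp add: adj_mult flip: mult.assoc)
      then have "g * adj g = 0" by (rule adj_mult_self_eq_0)
      then show "v * b * w = 0" unfolding g_def[symmetric] by (rule mult_adj_self_eq_0)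
    qed
    then show ?thesis using annihilatorsD(4)[OF ZB(4) VZ(1)] by simp
  qed
  have "b * v \<in> V" if "v \<in> V" "b \<in> B" for v b
  proof -
    have "adj v * adj b \<in> V" using that VZ(4) B by (intro vb) (simp_all add: cstar_subalgD)
    then have "adj (adj v * adj b) \<in> V" using VZ(4) by (simp add: cstar_subalgD)
    then show ?thesis by (simp add: adj_mult)
  qed
  then show "V \<in> {V \<in> central_ann B. V \<subseteq> Z}"
    using vb VB VZ(5) by (simp add: central_ann_iff[OF B])
qed

lemma central_support_central:
  assumes B: "cstar_subalg B" and Z: "Z \<in> central_ann B" and V: "V \<in> annihilators Z"
  shows "central_support Z V = central_support B V"
proof -
  note ZB = central_annD[OF B Z]
  have VB: "V \<in> annihilators B" "V \<subseteq> Z" using V annihilators_central[OF B Z] by auto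
  note cB = central_support[OF B VB(1)] and cZ = central_support[OF ZB(4) V]
  note eq = central_ann_central[OF B Z]
  show ?thesis
  proof
    show "central_support Z V \<subseteq> central_support B V"
      using cB(1,2) cB(3)[OF Z VB(2)] eq by (intro cZ(3)) auto
    show "central_support B V \<subseteq> central_support Z V"
      using cZ(1,2) eq by (intro cB(3)) auto
  qed
qed

lemma is_lub_P_central:
  assumes B: "cstar_subalg B" and Z: "Z \<in> central_ann B" and F: "F \<subseteq> annihilators Z"
  shows "is_lub_P Z F W \<longleftrightarrow> is_lub_P B F W"
proof -
  note ZB = central_annD[OF B Z]
  note eq = annihilators_central[OF B Z]
  have FB: "F \<subseteq> annihilators B" "\<And>V. V \<in> F \<Longrightarrow> V \<subseteq> Z" using F eq by auto
  have lub: "is_lub_P Z F X" if "is_lub_P B F X" for X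
  proof -
    have "X \<subseteq> Z" using that FB ZB(1) by (auto simp: is_lub_P_def)
    then show ?thesis using that eq by (auto simp: is_lub_P_def)
  qed
  show ?thesis
    using lub is_lub_P_iff[OF ZB(4) F] is_lub_P_iff[OF B FB(1)] by metis
qed

text \<open>The annihilators of \<open>Z\<close> are those of \<open>B\<close> below
  \<open>Z\<close>, with the same suprema and infima. In the application \<open>B\<close> is itself
  an annihilator \<open>V\<close> and \<open>Z\<close> its intersection with a central one.\<close>

lemma modular_central:
  assumes B: "cstar_subalg B" and Z: "Z \<in> central_ann B" and mod: "modular_alg B"
  shows "modular_alg Z"
proof -
  note ZB = central_annD[OF B Z]
  note eq = annihilators_central[OF B Z]
  have sup: "sup_P Z X Y = sup_P B X Y" if "X \<in> annihilators Z" "Y \<in> annihilators Z" for X Y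
    using is_lub_P_central[OF B Z, of "{X, Y}"] that
    unfolding sup_P_def by (intro arg_cong[where f = The] ext) simp
  have inf: "inf_P Z X Y = inf_P B X Y" "inf_P Z X Y \<in> annihilators Z"
    if "X \<in> annihilators Z" "Y \<in> annihilators Z" for X Y
    using that eq inf_P_eq[OF B] inf_P_eq[OF ZB(4)] Int_in_annihilators[OF ZB(4)] by auto
  have sup_in: "sup_P Z X Y \<in> annihilators Z" if "X \<in> annihilators Z" "Y \<in> annihilators Z" for X Y
  proof -
    have "is_lub_P Z {X, Y} (sup_P Z X Y)"
      using that sup_P_eq[OF ZB(4)] is_lub_P_iff[OF ZB(4), of "{X, Y}"] by simp
    then show ?thesis by (simp add: is_lub_P_def)
  qed
  show ?thesis
    unfolding modular_alg_def
  proof (intro ballI impI)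
    fix X Y W assume XYW: "X \<in> annihilators Z" "Y \<in> annihilators Z" "W \<in> annihilators Z" "X \<subseteq> W"
    then have "sup_P B X (inf_P B Y W) = inf_P B (sup_P B X Y) W"
      using mod eq by (auto simp: modular_alg_def)
    then show "sup_P Z X (inf_P Z Y W) = inf_P Z (sup_P Z X Y) W"
      using XYW by (simp add: sup inf sup_in flip: sup inf(1))
  qed
qed

text \<open>For \<open>v\<close> in \<open>V\<close> and \<open>z\<close> in \<open>Z\<close> the
  elements \<open>v z adj (v z)\<close> and \<open>adj (z v) z v\<close> lie in \<open>Z\<close>, an
  ideal, and in \<open>V\<close>, which is hereditary.\<close>

lemma disjoint_central_orthogonal:
  assumes B: "cstar_subalg B" and V: "V \<in> annihilators B" and Z: "Z \<in> central_ann B"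
    and disj: "V \<inter> Z \<subseteq> {0}"
  shows "V \<subseteq> perp B Z"
proof
  note VB = annihilatorsD[OF B V] and ZB = central_annD[OF B Z]
  fix v assume v: "v \<in> V"
  then have v': "v \<in> B" "adj v \<in> V" "adj v \<in> B" using VB by (auto simp: cstar_subalgD)
  have "v * z = 0 \<and> z * v = 0" if z: "z \<in> Z" for z
  proof
    have z': "z \<in> B" "adj z \<in> Z" using z ZB by (auto simp: cstar_subalgD)
    have "v * (z * adj z) * adj v \<in> V \<inter> Z"
      using v v' z z' ZB by (auto intro!: annihilator_hereditary[OF B V] simp: cstar_subalgD[OF B])
    then have "v * z * adj (v * z) = 0" using disj by (auto simp: adj_mult mult.assoc)
    then show "v * z = 0" by (rule mult_adj_self_eq_0)
    have "adj v * (adj z * z) * v \<in> V \<inter> Z"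
      using v v' z z' ZB by (auto intro!: annihilator_hereditary[OF B V] simp: cstar_subalgD[OF B])
    then have "adj (z * v) * (z * v) = 0" using disj by (auto simp: adj_mult mult.assoc)
    then show "z * v = 0" by (rule adj_mult_self_eq_0)
  qed
  then show "v \<in> perp B Z" using v'(1) by (simp add: perp_def)
qed

text \<open>\<open>V\<close> need not be central, so \<open>annihilators_central\<close> does not
  cover this. The double complement \<open>U\<close> of \<open>V \<inter> Z\<close> within
  \<open>V\<close> is an annihilator of \<open>B\<close> that meets \<open>perp B Z\<close>
  trivially, and this forces it into \<open>Z\<close>.\<close>

lemma Int_central:
  assumes B: "cstar_subalg B" and V: "V \<in> annihilators B" and Z: "Z \<in> central_ann B"
  shows "V \<inter> Z \<in> central_ann V"
proof -
  note VB = annihilatorsD[OF B V] and ZB = central_annD[OF B Z]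
  have VZ: "V \<inter> Z \<in> annihilators B" by (rule Int_in_annihilators[OF B V ZB(1)])
  have sc: "star_closed (V \<inter> Z)" by (rule annihilatorsD(3)[OF B VZ])
  define U where "U = perp V (perp V (V \<inter> Z))"
  have UV: "U \<in> annihilators V"
    unfolding U_def using sc VB(2) by (intro perp_in_annihilators perp_subset star_closed_perp)
  have U: "U \<in> annihilators B" by (rule annihilators_annihilator[OF B V UV])
  have "u = 0" if "u \<in> U" "u \<in> perp B Z" for u
  proof (rule mem_perp_self)
    show "u \<in> perp V (V \<inter> Z)"
      using that annihilatorsD(1)[OF VB(2) UV] by (auto simp: perp_def)
    show "u \<in> perp V (perp V (V \<inter> Z))" using that U_def by simp
    show "star_closed (perp V (V \<inter> Z))" using sc VB(2) by (intro star_closed_perp)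
  qed
  then have "U \<subseteq> perp B (perp B Z)"
    by (intro disjoint_central_orthogonal[OF B U central_perp[OF B Z]]) blast
  then have "U \<subseteq> Z" using annihilatorsD(4)[OF B ZB(1)] by simp
  then have "U = V \<inter> Z"
    using annihilatorsD(1)[OF VB(2) UV] subset_perp_perp[of "V \<inter> Z" V] by (auto simp: U_def)
  then show ?thesis
    using UV ZB VB by (auto simp: central_ann_iff[OF VB(2)] cstar_subalgD)
qed

section \<open>The type decomposition\<close>

text \<open>Commutativity of \<open>V\<close> allows rearranging the products so that the commutator
  \<open>d\<close>, itself in \<open>V\<close>, annihilates \<open>V\<close>; hence
  \<open>d * adj d = 0\<close>. The element \<open>a\<close> may come from a larger algebra in which
  \<open>V\<close> is an ideal.\<close>

lemma commute_ideal:
  fixes a v :: "'a::cstar_algebra"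
  assumes V: "cstar_subalg V" "abelian V"
    and ideal: "\<And>w. w \<in> V \<Longrightarrow> a * w \<in> V" "\<And>w. w \<in> V \<Longrightarrow> w * a \<in> V" and v: "v \<in> V"
  shows "a * v = v * a"
proof -
  have comm: "x * y = y * x" if "x \<in> V" "y \<in> V" for x y
    using V(2) that by (auto simp: abelian_def)
  define d where "d = a * v + scaleC (- 1) (v * a)"
  have d: "d = a * v - v * a" by (simp add: d_def scaleC_minus_one)
  have "adj d \<in> V" using ideal v V(1) by (simp add: d_def cstar_subalgD)
  moreover have "d * w = 0" if w: "w \<in> V" for w
  proof -
    have "v * a * w = v * (a * w)" by (rule mult.assoc)
    also have "\<dots> = a * w * v" using comm ideal(1)[OF w] v by blast
    also have "\<dots> = a * v * w" using comm[OF w v] by (simp add: mult.assoc)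
    finally show ?thesis by (simp add: d left_diff_distrib)
  qed
  ultimately have "d = 0" by (intro mult_adj_self_eq_0[of d]) auto
  then show ?thesis by (simp add: d)
qed

text \<open>The supremum \<open>W\<close> of the family meets the central support of each member \<open>V\<close> only in \<open>V\<close>, so
  each \<open>V\<close> is a commutative ideal of \<open>W\<close> and hence central in \<open>W\<close>. Commutators in \<open>W\<close> thus
  annihilate the whole family.\<close>

lemma abelian_supremum:
  assumes B: "cstar_subalg B" and F: "F \<subseteq> annihilators B" and ab: "\<And>V. V \<in> F \<Longrightarrow> abelian V"
    and orth: "\<And>V W. V \<in> F \<Longrightarrow> W \<in> F \<Longrightarrow> V \<noteq> W \<Longrightarrow>
      orthogonal (central_support B V) (central_support B W)"
  shows "abelian (perp B (perp B (\<Union>F)))"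
proof -
  define W where "W = perp B (perp B (\<Union>F))"
  note U = Union_annihilators[OF B F]
  have W: "W \<in> annihilators B"
    unfolding W_def using B U by (intro perp_in_annihilators star_closed_perp perp_subset)
  note WB = annihilatorsD[OF B W]
  have FW: "\<Union>F \<subseteq> W" unfolding W_def by (rule subset_perp_perp[OF U(1)])
  have meet: "W \<inter> central_support B V \<subseteq> V" if V: "V \<in> F" for V
  proof -
    have VB: "V \<in> annihilators B" using V F by blast
    define Z where "Z = central_support B V"
    note c = central_support[OF B VB, folded Z_def]
    have ZB: "cstar_subalg Z" "Z \<subseteq> B" using central_annD[OF B c(1)] by auto
    \<comment> \<open>An element of \<open>Z\<close> is orthogonal to the other members through
      their central supports, so inside \<open>Z\<close> orthogonality to \<open>V\<close> already
      means orthogonality to the whole family.\<close>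
    have "z * w = 0 \<and> w * z = 0" if z: "z \<in> perp Z V" and w: "w \<in> V'" and V': "V' \<in> F" for z w V'
    proof (cases "V' = V")
      case False
      have "V' \<subseteq> central_support B V'" using central_support(2)[OF B] V' F by blast
      then have "w \<in> central_support B V'" "z \<in> Z" using w z perp_subset by blast+
      then show ?thesis
        using orth[OF V V'] orth[OF V' V] False by (auto simp: orthogonal_def Z_def)
    qed (use perpD[OF z] w in auto)
    then have "perp Z V \<subseteq> perp B (\<Union>F)"
      using ZB(2) perp_subset[of Z V] unfolding perp_def[of B "\<Union>F"] by blast
    then have "W \<inter> Z \<subseteq> perp Z (perp Z V)"
      unfolding W_def perp_def[of B "perp B (\<Union>F)"] perp_def[of Z "perp Z V"] by blast
    moreover have "V \<in> annihilators Z" using annihilators_central[OF B c(1)] VB c(2) by simp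
    ultimately show ?thesis using annihilatorsD(4)[OF ZB(1)] by (simp add: Z_def)
  qed
  have ideal: "a * v \<in> V \<and> v * a \<in> V" if "a \<in> W" "v \<in> V" "V \<in> F" for a v V
  proof -
    have VB: "V \<in> annihilators B" using that F by blast
    note c = central_support[OF B VB]
    have "v \<in> central_support B V" "v \<in> W" "a \<in> B" using that c(2) FW WB(1) by blast+
    then have "a * v \<in> W \<inter> central_support B V" "v * a \<in> W \<inter> central_support B V"
      using that central_annD[OF B c(1)] WB(2) by (simp_all add: cstar_subalgD)
    then show ?thesis using meet that by blast
  qed
  have comm: "a * v = v * a" if "a \<in> W" "v \<in> V" "V \<in> F" for a v V
    using that ideal ab F annihilatorsD(2)[OF B] by (intro commute_ideal[of V]) auto
  have "a * b = b * a" if a: "a \<in> W" and b: "b \<in> W" for a b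
  proof -
    define k where "k = a * b + scaleC (- 1) (b * a)"
    have k: "k = a * b - b * a" by (simp add: k_def scaleC_minus_one)
    have kW: "k \<in> W" using a b WB(2) by (simp add: k_def cstar_subalgD)
    have "k * v = 0 \<and> v * k = 0" if v: "v \<in> V" "V \<in> F" for v V
    proof
      have "a * b * v = a * (b * v)" by (rule mult.assoc)
      also have "\<dots> = b * v * a" using comm[OF a _ v(2)] ideal[OF b v] by blast
      also have "\<dots> = b * a * v" using comm[OF a v] by (simp add: mult.assoc)
      finally show "k * v = 0" by (simp add: k left_diff_distrib)
      have "v * (b * a) = v * b * a" by (simp add: mult.assoc)
      also have "\<dots> = a * (v * b)" using comm[OF a _ v(2)] ideal[OF b v] by metis
      also have "\<dots> = v * (a * b)" using comm[OF a v] by (simp flip: mult.assoc)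
      finally show "v * k = 0" by (simp add: k right_diff_distrib)
    qed
    then have "k \<in> perp B (\<Union>F)" using kW WB(1) unfolding perp_def by blast
    then have "k = 0"
      using kW unfolding W_def by (intro mem_perp_self[OF star_closed_perp[OF B U(2)]])
    then show ?thesis by (simp add: k)
  qed
  then show ?thesis by (simp add: abelian_def W_def)
qed

text \<open>Zorn's lemma, with \<open>Q\<close> left open because Abelian and modular annihilators
  are treated alike. The complement of all supports is central, so it contains with a
  \<open>V\<close> also the central support of \<open>V\<close>, and \<open>V\<close> could be
  adjoined.\<close>

lemma maximal_orthogonal_family:
  assumes B: "cstar_subalg B"
  obtains F where "F \<subseteq> annihilators B" "\<And>V. V \<in> F \<Longrightarrow> Q V"
    "\<And>V W. V \<in> F \<Longrightarrow> W \<in> F \<Longrightarrow> V \<noteq> W \<Longrightarrow> orthogonal (central_support B V) (central_support B W)"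
    "\<And>V. V \<in> annihilators B \<Longrightarrow> Q V \<Longrightarrow> V \<subseteq> perp B (\<Union>(central_support B ` F)) \<Longrightarrow> V = {0}"
proof -
  let ?c = "central_support B"
  define P where "P F \<longleftrightarrow> F \<subseteq> {V \<in> annihilators B. Q V} \<and>
    (\<forall>V\<in>F. \<forall>W\<in>F. V \<noteq> W \<longrightarrow> orthogonal (?c V) (?c W))" for F
  have "\<exists>M\<in>Collect P. \<forall>X\<in>Collect P. M \<subseteq> X \<longrightarrow> X = M"
  proof (rule Zorn_Lemma, intro ballI)
    fix C assume C: "C \<in> chains (Collect P)"
    have PC: "P F" if "F \<in> C" for F using C that by (auto simp: chains_def)
    have "orthogonal (?c V) (?c W)" if "V \<in> F" "F \<in> C" "W \<in> G" "G \<in> C" "V \<noteq> W" for V W F G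
    proof -
      have "F \<subseteq> G \<or> G \<subseteq> F" using C that by (auto simp: chains_def chain_subset_def)
      then show ?thesis using that PC[of F] PC[of G] unfolding P_def by blast
    qed
    moreover have "\<Union>C \<subseteq> {V \<in> annihilators B. Q V}" using PC unfolding P_def by blast
    ultimately show "\<Union>C \<in> Collect P" unfolding P_def by blast
  qed
  then obtain F where F: "P F" and max: "\<And>X. P X \<Longrightarrow> F \<subseteq> X \<Longrightarrow> X = F" by blast
  have FB: "F \<subseteq> annihilators B" using F by (auto simp: P_def)
  have cF: "?c ` F \<subseteq> central_ann B" using central_support(1)[OF B] FB by blast
  show thesis
  proof (rule that[OF FB])
    show "Q V" if "V \<in> F" for V using F that by (auto simp: P_def)
    show "orthogonal (?c V) (?c W)" if "V \<in> F" "W \<in> F" "V \<noteq> W" for V W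
      using F that by (auto simp: P_def)
    fix V assume V: "V \<in> annihilators B" "Q V" "V \<subseteq> perp B (\<Union>(?c ` F))"
    have "?c V \<subseteq> perp B (\<Union>(?c ` F))"
      by (rule central_support(3)[OF B V(1) central_perp_Union[OF B cF] V(3)])
    then have "orthogonal (?c V) (?c W) \<and> orthogonal (?c W) (?c V)" if "W \<in> F" for W
      using that unfolding orthogonal_def perp_def by blast
    then have "P (insert V F)" using F V by (auto simp: P_def)
    \<comment> \<open>Maximality only shows that \<open>V\<close> is already a member. It then lies
      in the union of the supports and is orthogonal to it, so it is \<open>{0}\<close>, which may
      well belong to the family.\<close>
    then have "V \<in> F" using max by blast
    then have "V \<subseteq> \<Union>(?c ` F)" using central_support(2)[OF B V(1)] by blast
    then have "v = 0" if "v \<in> V" for v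
      using that V(3) annihilatorsD(3)[OF B V(1)] perp_antimono by (intro mem_perp_self[of V v B]) blast+
    moreover have "0 \<in> V" using annihilatorsD(2)[OF B V(1)] by (simp add: cstar_subalgD)
    ultimately show "V = {0}" by blast
  qed
qed

lemma central_hull:
  assumes B: "cstar_subalg B" and F: "F \<subseteq> annihilators B"
    and E: "E = perp B (perp B (\<Union>(central_support B ` F)))"
  shows "E \<in> central_ann B" "F \<subseteq> annihilators E"
    "perp B E = perp B (\<Union>(central_support B ` F))"
    "\<And>V. V \<in> F \<Longrightarrow> central_support E V = central_support B V"
    "is_lub_P E (central_support E ` F) E"
proof -
  let ?C = "central_support B ` F"
  have C: "?C \<subseteq> central_ann B" using central_support(1)[OF B] F by blast
  then have CB: "?C \<subseteq> annihilators B" using central_annD(1)[OF B] by blast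
  show Ec: "E \<in> central_ann B" unfolding E by (intro central_perp[OF B] central_perp_Union[OF B C])
  have sub: "\<Union>?C \<subseteq> E" unfolding E by (intro subset_perp_perp Union_annihilators[OF B CB])
  then have "V \<subseteq> E" if "V \<in> F" for V using that central_support(2)[OF B] F by blast
  then show FE: "F \<subseteq> annihilators E" using annihilators_central[OF B Ec] F by blast
  show "perp B E = perp B (\<Union>?C)"
    unfolding E by (rule perp_perp_perp[OF Union_annihilators(1)[OF B CB]])
  show eq: "central_support E V = central_support B V" if "V \<in> F" for V
    using central_support_central[OF B Ec] FE that by blast
  have "?C \<subseteq> annihilators E" using annihilators_central[OF B Ec] CB sub by blast
  then have "is_lub_P E ?C E" using is_lub_P_central[OF B Ec] is_lub_P_iff[OF B CB] E by blast
  moreover have "central_support E ` F = ?C" using eq by (intro image_cong) auto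
  ultimately show "is_lub_P E (central_support E ` F) E" by simp
qed

text \<open>The single Abelian annihilator demanded by type I is the supremum of the family: its
  central support in \<open>E\<close> dominates those of all members, hence their supremum
  \<open>E\<close>.\<close>

lemma vN_type_I_central_hull:
  assumes B: "cstar_subalg B" and F: "F \<subseteq> annihilators B" and ab: "\<And>V. V \<in> F \<Longrightarrow> abelian V"
    and orth: "\<And>V W. V \<in> F \<Longrightarrow> W \<in> F \<Longrightarrow> V \<noteq> W \<Longrightarrow>
      orthogonal (central_support B V) (central_support B W)"
    and E: "E = perp B (perp B (\<Union>(central_support B ` F)))"
  shows "vN_type_I E"
proof -
  define W where "W = perp B (perp B (\<Union>F))"
  note hull = central_hull[OF B F E]
  note EB = central_annD[OF B hull(1)]
  have lub: "is_lub_P B F W" using is_lub_P_iff[OF B F] W_def by simp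
  then have W: "W \<in> annihilators B" by (simp add: is_lub_P_def)
  have "\<forall>V\<in>F. V \<subseteq> E" using hull(2) annihilatorsD(1)[OF EB(4)] by blast
  then have "W \<subseteq> E" using lub EB(1) by (simp add: is_lub_P_def)
  then have WE: "W \<in> annihilators E" using annihilators_central[OF B hull(1)] W by simp
  have "central_support E W = E"
  proof
    note c = central_support[OF EB(4) WE]
    note cE = central_annD[OF EB(4) c(1)]
    show "central_support E W \<subseteq> E" by (rule cE(5))
    have "central_support E V \<subseteq> central_support E W" if "V \<in> F" for V
      using that hull(2) lub c(1,2)
      by (intro central_support(3)[OF EB(4)]) (auto simp: is_lub_P_def)
    then show "E \<subseteq> central_support E W" using hull(5) cE(1) by (auto simp: is_lub_P_def)
  qed
  moreover have "abelian W" unfolding W_def by (rule abelian_supremum[OF B F ab orth])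
  ultimately show ?thesis using WE by (auto simp: vN_type_I_def)
qed

section \<open>Orthogonality of summands of different types\<close>

lemma no_abelian_ann_orthogonal:
  assumes B: "cstar_subalg B" and X: "X \<in> central_ann B" and Y: "Y \<in> central_ann B"
    and "vN_type_I X" "no_abelian_ann Y"
  shows "X \<subseteq> perp B Y"
proof -
  note XB = central_annD[OF B X] and YB = central_annD[OF B Y]
  obtain V where VX: "V \<in> annihilators X" and ab: "abelian V" and c: "central_support X V = X"
    using assms(4) by (auto simp: vN_type_I_def)
  have V: "V \<in> annihilators B" using annihilators_central[OF B X] VX by simp
  have "V \<inter> Y \<in> annihilators Y"
    using annihilators_central[OF B Y] Int_in_annihilators[OF B V YB(1)] by simp
  moreover have "abelian (V \<inter> Y)" using ab by (simp add: abelian_def)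
  ultimately have "V \<inter> Y = {0}" using assms(5) by (simp add: no_abelian_ann_def)
  then have "V \<subseteq> perp B Y" by (intro disjoint_central_orthogonal[OF B V Y]) simp
  then have "central_support B V \<subseteq> perp B Y"
    by (rule central_support(3)[OF B V central_perp[OF B Y]])
  then show ?thesis using central_support_central[OF B X VX] c by simp
qed

text \<open>Commutativity passes to subsets, modularity does not: \<open>V \<inter> Y\<close>
  inherits it from \<open>V\<close> as a central annihilator of \<open>V\<close>. So the
  intersection is zero, and \<open>perp B Y\<close>, being central, contains the central support of
  each member.\<close>

lemma purely_nonmodular_orthogonal:
  assumes B: "cstar_subalg B" and X: "X \<in> central_ann B" and Y: "Y \<in> central_ann B"
    and "locally_modular X" "purely_nonmodular Y"
  shows "X \<subseteq> perp B Y"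
proof -
  note XB = central_annD[OF B X] and YB = central_annD[OF B Y]
  obtain F where F: "F \<subseteq> annihilators X" "\<And>V. V \<in> F \<Longrightarrow> modular_alg V"
    and lub: "is_lub_P X (central_support X ` F) X"
    using assms(4) by (auto simp: locally_modular_def)
  have "central_support X V \<subseteq> perp B Y" if VF: "V \<in> F" for V
  proof -
    have VX: "V \<in> annihilators X" using F VF by blast
    then have V: "V \<in> annihilators B" using annihilators_central[OF B X] by simp
    have "V \<inter> Y \<in> annihilators Y"
      using annihilators_central[OF B Y] Int_in_annihilators[OF B V YB(1)] by simp
    moreover have "modular_alg (V \<inter> Y)"
      by (rule modular_central[OF annihilatorsD(2)[OF B V] Int_central[OF B V Y] F(2)[OF VF]])
    ultimately have "V \<inter> Y = {0}" using assms(5) by (simp add: purely_nonmodular_def)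
    then have "V \<subseteq> perp B Y" by (intro disjoint_central_orthogonal[OF B V Y]) simp
    then have "central_support B V \<subseteq> perp B Y"
      by (rule central_support(3)[OF B V central_perp[OF B Y]])
    then show ?thesis using central_support_central[OF B X VX] by simp
  qed
  moreover have "central_support X ` F \<subseteq> annihilators X"
    using central_support(1)[OF XB(4)] central_annD(1)[OF XB(4)] F(1) by blast
  then have "is_lub_P B (central_support X ` F) X" using lub is_lub_P_central[OF B X] by simp
  moreover have "perp B Y \<in> annihilators B" using annihilatorsD(5)[OF B YB(1)] .
  ultimately show ?thesis by (auto simp: is_lub_P_def)
qed

text \<open>Closedness is the point: \<open>(x + y) * adj x = x * adj x\<close> gives
  \<open>norm x \<le> norm (x + y)\<close>, so the first components of a convergent sequence
  converge too.\<close>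

lemma cstar_subalg_orthogonal_sum:
  assumes X: "cstar_subalg X" and Y: "cstar_subalg Y" and orth: "orthogonal X Y" "orthogonal Y X"
  shows "cstar_subalg {x + y | x y. x \<in> X \<and> y \<in> Y}" (is "cstar_subalg ?S")
proof -
  have SI: "x + y \<in> ?S" if "x \<in> X" "y \<in> Y" for x y using that by blast
  have xy: "x * y = 0" "y * x = 0" if "x \<in> X" "y \<in> Y" for x y
    using orth that by (auto simp: orthogonal_def)
  have norm_le: "norm x \<le> norm (x + y)" if "x \<in> X" "y \<in> Y" for x y
  proof (cases "x = 0")
    case False
    have "(x + y) * adj x = x * adj x"
      using that xy X by (simp add: distrib_right cstar_subalgD)
    then have "norm x * norm x \<le> norm (x + y) * norm x"
      using norm_mult_ineq[of "x + y" "adj x"]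
      by (simp add: norm_mult_adj_self norm_adj power2_eq_square)
    then show ?thesis using False by simp
  qed simp
  have "closed ?S"
    unfolding closed_sequential_limits
  proof (intro allI impI, elim conjE)
    fix u l assume uS: "\<forall>n. u n \<in> ?S" and ul: "u \<longlonglongrightarrow> l"
    have "\<forall>n. \<exists>x. x \<in> X \<and> u n - x \<in> Y"
    proof
      fix n
      obtain x y where "u n = x + y" "x \<in> X" "y \<in> Y" using uS by blast
      then show "\<exists>x. x \<in> X \<and> u n - x \<in> Y" by (intro exI[of _ x]) simp
    qed
    then obtain x where x: "\<And>n. x n \<in> X" "\<And>n. u n - x n \<in> Y" by metis
    have diff: "a - b \<in> V" if "cstar_subalg V" "a \<in> V" "b \<in> V" for a b and V :: "'a set"
      using cstar_subalgD(2)[OF that(1,2) cstar_subalgD(4)[OF that(1,3), of "- 1"]]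
      by (simp add: scaleC_minus_one)
    have le: "norm (x m - x n) \<le> norm (u m - u n)" for m n
    proof -
      have "x m - x n \<in> X" "(u m - x m) - (u n - x n) \<in> Y" using diff X Y x by blast+
      from norm_le[OF this] show ?thesis by (simp add: algebra_simps)
    qed
    have "Cauchy u" using ul by (intro LIMSEQ_imp_Cauchy)
    have "Cauchy x"
    proof (rule CauchyI)
      fix e :: real assume "e > 0"
      then obtain M where "\<forall>m\<ge>M. \<forall>n\<ge>M. norm (u m - u n) < e"
        using CauchyD[OF \<open>Cauchy u\<close>] by blast
      then show "\<exists>M. \<forall>m\<ge>M. \<forall>n\<ge>M. norm (x m - x n) < e"
        using le by (meson le_less_trans)
    qed
    then obtain z where z: "x \<longlonglongrightarrow> z" by (metis Cauchy_convergent_iff convergent_def)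
    have "z \<in> X" using closed_sequentially[OF cstar_subalgD(6)[OF X] _ z] x by blast
    moreover have "l - z \<in> Y"
      using closed_sequentially[OF cstar_subalgD(6)[OF Y] _ tendsto_diff[OF ul z]] x by blast
    ultimately show "l \<in> ?S" using SI[of z "l - z"] by simp
  qed
  moreover have "a + b \<in> ?S \<and> a * b \<in> ?S" if a: "a \<in> ?S" and b: "b \<in> ?S" for a b
  proof -
    obtain x y where xy1: "a = x + y" "x \<in> X" "y \<in> Y" using a by blast
    obtain x' y' where xy2: "b = x' + y'" "x' \<in> X" "y' \<in> Y" using b by blast
    have "a + b = (x + x') + (y + y')" using xy1 xy2 by simp
    moreover have "a * b = x * x' + y * y'" using xy1 xy2 xy by (simp add: distrib_left distrib_right)
    ultimately show ?thesis using SI xy1 xy2 X Y by (simp only: cstar_subalgD)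
  qed
  moreover have "scaleC c a \<in> ?S \<and> adj a \<in> ?S" if a: "a \<in> ?S" for a c
  proof -
    obtain x y where xy1: "a = x + y" "x \<in> X" "y \<in> Y" using a by blast
    then show ?thesis using SI X Y by (simp only: scaleC_add_right adj_add cstar_subalgD)
  qed
  moreover have "0 \<in> ?S" using SI[of 0 0] X Y by (simp add: cstar_subalgD)
  ultimately show ?thesis by (simp add: cstar_subalg_def)
qed

lemma cstar_subalg_sum3:
  assumes X: "cstar_subalg X" "cstar_subalg Y" "cstar_subalg Z"
    and orth: "orthogonal X Y" "orthogonal Y X" "orthogonal X Z" "orthogonal Z X"
      "orthogonal Y Z" "orthogonal Z Y"
  shows "cstar_subalg (sum3 X Y Z)"
proof -
  let ?S = "{x + y | x y. x \<in> X \<and> y \<in> Y}"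
  have "orthogonal ?S Z" "orthogonal Z ?S"
    using orth by (auto simp: orthogonal_def distrib_left distrib_right)
  then have "cstar_subalg {s + z | s z. s \<in> ?S \<and> z \<in> Z}"
    using assms by (intro cstar_subalg_orthogonal_sum) auto
  moreover have "{s + z | s z. s \<in> ?S \<and> z \<in> Z} = sum3 X Y Z" unfolding sum3_def by blast
  ultimately show ?thesis by simp
qed

section \<open>Uniqueness and existence\<close>

lemma perp_commute: "X \<subseteq> perp B Y \<Longrightarrow> Y \<subseteq> B \<Longrightarrow> Y \<subseteq> perp B X"
  unfolding perp_def by blast

lemma orthogonal_of_perp: "X \<subseteq> perp B Y \<Longrightarrow> orthogonal X Y \<and> orthogonal Y X"
  unfolding perp_def orthogonal_def by blast

text \<open>The part of \<open>V\<close> orthogonal to \<open>Z\<close> is orthogonal to all three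
  of \<open>Z\<close>, \<open>P\<close>, \<open>R\<close>, hence zero; so \<open>V\<close> lies in
  the double complement of \<open>Z\<close>.\<close>

lemma central_subset_of_orthogonal:
  assumes B: "cstar_subalg B" and V: "V \<in> annihilators B" and Z: "Z \<in> central_ann B"
    and "V \<subseteq> perp B P" "V \<subseteq> perp B R"
    and zero: "\<And>e. e \<in> perp B Z \<Longrightarrow> e \<in> perp B P \<Longrightarrow> e \<in> perp B R \<Longrightarrow> e = 0"
  shows "V \<subseteq> Z"
proof -
  have "V \<inter> perp B Z \<subseteq> {0}" using assms(4,5) zero by blast
  then have "V \<subseteq> perp B (perp B Z)"
    by (rule disjoint_central_orthogonal[OF B V central_perp[OF B Z]])
  then show ?thesis using annihilatorsD(4)[OF B central_annD(1)[OF B Z]] by simp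
qed

lemma type_decomposition_subset:
  assumes A: "cstar_subalg A"
    and D: "type_decomposition A X Y Z" and D': "type_decomposition A X' Y' Z'"
  shows "X' \<subseteq> X \<and> Y' \<subseteq> Y \<and> Z' \<subseteq> Z"
proof -
  have c: "X \<in> central_ann A" "Y \<in> central_ann A" "Z \<in> central_ann A"
    "X' \<in> central_ann A" "Y' \<in> central_ann A" "Z' \<in> central_ann A"
    using D D' by (simp_all add: type_decomposition_def)
  note sub = c[THEN central_annD(5)[OF A]] and ann = c[THEN central_annD(1)[OF A]]
  have types: "vN_type_I X" "no_abelian_ann Y" "no_abelian_ann Z" "locally_modular Y" "purely_nonmodular Z"
    "vN_type_I X'" "no_abelian_ann Y'" "no_abelian_ann Z'" "locally_modular Y'" "purely_nonmodular Z'"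
    using D D' by (simp_all add: type_decomposition_def)
  have zero: "e = 0" if "e \<in> perp A X" "e \<in> perp A Y" "e \<in> perp A Z" for e
  proof -
    have "e * (x + y + z) + (x + y + z) * e = 0" if "x \<in> X" "y \<in> Y" "z \<in> Z" for x y z
      using perpD[OF \<open>e \<in> perp A X\<close> that(1)] perpD[OF \<open>e \<in> perp A Y\<close> that(2)]
        perpD[OF \<open>e \<in> perp A Z\<close> that(3)] by (simp add: distrib_left distrib_right)
    then have "e \<in> Ann A (sum3 X Y Z)"
      using that(1) perp_subset[of A X] by (auto simp: Ann_def sum3_def)
    then show ?thesis using D by (simp add: type_decomposition_def)
  qed
  have X': "X' \<subseteq> perp A Y" "X' \<subseteq> perp A Z"
    using no_abelian_ann_orthogonal[OF A] c types by blast+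
  \<comment> \<open>The orthogonality lemmas have the lower type on the left, so three of these
    relations start from an unprimed summand and are reversed afterwards.\<close>
  have "X \<subseteq> perp A Y'" "X \<subseteq> perp A Z'" "Y \<subseteq> perp A Z'" and Y': "Y' \<subseteq> perp A Z"
    using no_abelian_ann_orthogonal[OF A] purely_nonmodular_orthogonal[OF A] c types by blast+
  then have perps: "Y' \<subseteq> perp A X" "Z' \<subseteq> perp A X" "Z' \<subseteq> perp A Y"
    using perp_commute sub by blast+
  show ?thesis
    using central_subset_of_orthogonal[OF A ann(4) c(1) X']
      central_subset_of_orthogonal[OF A ann(5) c(2) perps(1) Y']
      central_subset_of_orthogonal[OF A ann(6) c(3) perps(2,3)] zero by blast
qed

lemma type_decomposition_exists:
  assumes A: "cstar_subalg A"
  shows "\<exists>AI AII AIII. type_decomposition A AI AII AIII"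
proof -
  obtain F where F: "F \<subseteq> annihilators A" "\<And>V. V \<in> F \<Longrightarrow> abelian V"
    "\<And>V W. V \<in> F \<Longrightarrow> W \<in> F \<Longrightarrow> V \<noteq> W \<Longrightarrow> orthogonal (central_support A V) (central_support A W)"
    and Fmax: "\<And>V. V \<in> annihilators A \<Longrightarrow> abelian V \<Longrightarrow>
      V \<subseteq> perp A (\<Union>(central_support A ` F)) \<Longrightarrow> V = {0}"
    using maximal_orthogonal_family[OF A, of abelian] by metis
  define X where "X = perp A (perp A (\<Union>(central_support A ` F)))"
  note hX = central_hull[OF A F(1) X_def]
  have XI: "vN_type_I X" by (rule vN_type_I_central_hull[OF A F X_def])
  define C where "C = perp A X"
  have Cc: "C \<in> central_ann A" unfolding C_def by (rule central_perp[OF A hX(1)])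
  note CA = central_annD[OF A Cc]
  \<comment> \<open>Choosing the second family inside \<open>C\<close> ensures that no nonzero
    Abelian annihilator is left for either of the remaining summands.\<close>
  obtain G where G: "G \<subseteq> annihilators C" "\<And>V. V \<in> G \<Longrightarrow> modular_alg V"
    "\<And>V W. V \<in> G \<Longrightarrow> W \<in> G \<Longrightarrow> V \<noteq> W \<Longrightarrow> orthogonal (central_support C V) (central_support C W)"
    and Gmax: "\<And>V. V \<in> annihilators C \<Longrightarrow> modular_alg V \<Longrightarrow>
      V \<subseteq> perp C (\<Union>(central_support C ` G)) \<Longrightarrow> V = {0}"
    using maximal_orthogonal_family[OF CA(4), of modular_alg] by metis
  define Y where "Y = perp C (perp C (\<Union>(central_support C ` G)))"
  note hY = central_hull[OF CA(4) G(1) Y_def]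
  define Z where "Z = perp C Y"
  have ZC: "Z \<in> central_ann C" unfolding Z_def by (rule central_perp[OF CA(4) hY(1)])
  have c: "X \<in> central_ann A" "Y \<in> central_ann A" "Z \<in> central_ann A"
    using hX(1) hY(1) ZC central_ann_central[OF A Cc] by auto
  note sub = c[THEN central_annD(5)[OF A]] and alg = c[THEN central_annD(4)[OF A]]
  have YC: "Y \<subseteq> C" and ZC': "Z \<subseteq> C" using hY(1) ZC central_annD(5)[OF CA(4)] by auto
  have no_ab: "no_abelian_ann E" if "E \<in> central_ann A" "E \<subseteq> C" for E
    unfolding no_abelian_ann_def
  proof (intro ballI impI)
    fix V assume "V \<in> annihilators E" "abelian V"
    then show "V = {0}"
      using annihilators_central[OF A that(1)] that(2) hX(3) by (intro Fmax) (auto simp: C_def)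
  qed
  have lm: "locally_modular Y"
    unfolding locally_modular_def using G(2,3) hY(2,4,5) by (intro exI[of _ G]) auto
  have pn: "purely_nonmodular Z"
    unfolding purely_nonmodular_def
  proof (intro ballI impI)
    fix V assume "V \<in> annihilators Z" "modular_alg V"
    then show "V = {0}"
      using annihilators_central[OF CA(4) ZC] hY(3) by (intro Gmax) (auto simp: Z_def)
  qed
  have orth: "orthogonal X Y" "orthogonal Y X" "orthogonal X Z" "orthogonal Z X"
    "orthogonal Y Z" "orthogonal Z Y"
    using orthogonal_of_perp[of Y A X] orthogonal_of_perp[of Z A X] orthogonal_of_perp[of Z C Y]
      YC ZC' by (auto simp: C_def Z_def)
  have S: "cstar_subalg (sum3 X Y Z)" by (rule cstar_subalg_sum3[OF alg orth])
  have SA: "sum3 X Y Z \<subseteq> A"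
    using sub A unfolding sum3_def by (auto intro!: cstar_subalgD(2)[OF A])
  have z: "0 \<in> X" "0 \<in> Y" "0 \<in> Z" using alg by (simp_all add: cstar_subalgD)
  have XS: "X \<subseteq> sum3 X Y Z" "Y \<subseteq> sum3 X Y Z" "Z \<subseteq> sum3 X Y Z"
    using z unfolding sum3_def by (force intro: exI[of _ 0])+
  have "a = 0" if a: "a \<in> Ann A (sum3 X Y Z)" for a
  proof -
    have "a \<in> perp A (sum3 X Y Z)" using a Ann_subalg[OF S] by simp
    then have perps: "a \<in> perp A X" "a \<in> perp A Y" "a \<in> perp A Z"
      using XS perp_antimono by blast+
    then have "a \<in> Z" by (simp add: Z_def C_def perp_def)
    then show ?thesis using mem_perp_self[OF star_closed_subalg[OF alg(3)]] perps(3) by blast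
  qed
  moreover have "0 \<in> Ann A (sum3 X Y Z)" using A by (simp add: Ann_def cstar_subalgD)
  ultimately have "Ann A (sum3 X Y Z) = {0}" by blast
  then have "type_decomposition A X Y Z"
    unfolding type_decomposition_def
    using alg sub XI no_ab[OF c(2) YC] no_ab[OF c(3) ZC'] lm pn c orth S SA by simp
  then show ?thesis by blast
qed

theorem theorem21:
  fixes A :: "'a::cstar_algebra set"
  assumes "cstar_subalg A"
  shows "\<exists>AI AII AIII. type_decomposition A AI AII AIII
           \<and> (\<forall>X Y Z. type_decomposition A X Y Z \<longrightarrow> X = AI \<and> Y = AII \<and> Z = AIII)"
proof -
  obtain X Y Z where D: "type_decomposition A X Y Z"
    using type_decomposition_exists[OF assms] by blast
  have "X' = X \<and> Y' = Y \<and> Z' = Z" if "type_decomposition A X' Y' Z'" for X' Y' Z'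
    using type_decomposition_subset[OF assms D that] type_decomposition_subset[OF assms that D] by blast
  then show ?thesis using D by blast
qed

end
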